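(* Let $(a_n)_{n\in\mathbb{N}}$ and $(b_{n,j})_{n,j\in\mathbb{N}}$ be real numbers with $a_n\ge 0$ for all $n$, $b_{n,j}\ge 0$ for all $n,j$, and $b_{n,j}=0$ whenever $n\ge j$. Let $w$ be a weight such that $w_n\ge n$ for all $n\in\mathbb{N}$ and such that there exists $\kappa\in(0,1]$ with $\sum_{n=1}^{j-1}w_nb_{n,j}\le\kappa w_j$ for all $j=2,3,\ldots$. Let $(c_n)_{n=1}^\infty$ satisfy $c_n\le c_{n+1}$ and $a_n\le c_n$ for all $n\in\mathbb{N}$. For $\mathring{u}\in\mathcal{D}(C^{(w)})$, the abstract Cauchy problem $$u'(t)=A^{(w)}u(t)+B^{(w)}u(t),\quad t>0;\qquad u(0)=\mathring{u},$$ has a unique classical solution, given by $u(t)=S^{(w)}(t)\mathring{u}$, $t\ge0$. If $\mathring{u}\in\mathcal{D}(C^{(w)})_+$, then this solution is non-negative. Moreover, if $a_1=0$ and $\sum_{n=1}^{j-1}nb_{n,j}=j$ for all $j=2,3,\ldots$, and $\mathring{u}\in\mathcal{D}(C^{(w)})_+$, then the solution is mass conserving.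
   Context: $\mathbb{N}=\{1,2,\ldots\}$. A weight is a sequence $w=(w_n)_{n=1}^\infty$ of strictly positive reals, and $\ell_w^1$ is the Banach space of real sequences $f=(f_n)_{n=1}^\infty$ with $\|f\|_w=\sum_{n=1}^\infty w_n|f_n|<\infty$, ordered componentwise. For a subspace $D$, $D_+$ denotes the set of its non-negative elements. Operators: $A^{(w)}f=(-a_nf_n)_{n=1}^\infty$ with $\mathcal{D}(A^{(w)})=\{f\in\ell_w^1:(a_nf_n)_n\in\ell_w^1\}$; $B^{(w)}f=\bigl(\sum_{j=n+1}^\infty a_jb_{n,j}f_j\bigr)_{n=1}^\infty$ with $\mathcal{D}(B^{(w)})$ the set of $f\in\ell_w^1$ for which this sequence is well defined and lies in $\ell_w^1$; $[C^{(w)}f]_n=-c_nf_n$ with $\mathcal{D}(C^{(w)})=\{f\in\ell_w^1:\sum_{n=1}^\infty w_nc_n|f_n|<\infty\}$. Under the stated hypotheses on $a_n,b_{n,j},w$, the closure $G^{(w)}=\overline{A^{(w)}+B^{(w)}}$ generates a substochastic $C_0$-semigroup on $\ell_w^1$ (positive, and contractive on the positive cone), denoted $(S^{(w)}(t))_{t\ge0}$. A classical solution is a function $u\in C^1((0,\infty),\ell_w^1)\cap C([0,\infty),\ell_w^1)$ with $u(t)\in\mathcal{D}(A^{(w)})\cap\mathcal{D}(B^{(w)})$ for all $t>0$ that satisfies the equation and the initial condition. It is non-negative if $u(t)\ge0$ for all $t\ge0$, and mass conserving if $M_1(u(t))=M_1(\mathring{u})$ for all $t\ge0$, where $M_1(f)=\sum_{n=1}^\infty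 nf_n$. *)

theory Defs
  imports "HOL-Analysis.Analysis"
begin

text \<open>
  Sequences indexed by \<open>{1,2,\<dots>}\<close> are functions on \<^typ>\<open>nat\<close>. Index \<open>0\<close> is a dummy: elements of
  the sequence space vanish there, so that equality of functions is equality of sequences,
  while for weights and coefficients the entries at \<open>0\<close> are never used.
\<close>

definition ell1_norm :: "(nat \<Rightarrow> real) \<Rightarrow> (nat \<Rightarrow> real) \<Rightarrow> real" where
  "ell1_norm w f = (\<Sum>n. w (Suc n) * \<bar>f (Suc n)\<bar>)"

definition ell1 :: "(nat \<Rightarrow> real) \<Rightarrow> (nat \<Rightarrow> real) set" where
  "ell1 w = {f. f 0 = 0 \<and> summable (\<lambda>n. w (Suc n) * \<bar>f (Suc n)\<bar>)}"

text \<open>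
  Norm convergence along a filter. It is only used where the function involved
  eventually takes its values in \<open>ell1 w\<close>, so that \<open>ell1_norm\<close> is meaningful.
\<close>

definition ell1_tendsto ::
  "(nat \<Rightarrow> real) \<Rightarrow> ('t \<Rightarrow> nat \<Rightarrow> real) \<Rightarrow> (nat \<Rightarrow> real) \<Rightarrow> 't filter \<Rightarrow> bool" where
  "ell1_tendsto w X f F \<longleftrightarrow> ((\<lambda>x. ell1_norm w (\<lambda>n. X x n - f n)) \<longlongrightarrow> 0) F"

definition ell1_continuous_on ::
  "(nat \<Rightarrow> real) \<Rightarrow> real set \<Rightarrow> (real \<Rightarrow> nat \<Rightarrow> real) \<Rightarrow> bool" where
  "ell1_continuous_on w I u \<longleftrightarrow>
     (\<forall>t\<in>I. u t \<in> ell1 w) \<and> (\<forall>t\<in>I. ell1_tendsto w u (u t) (at t within I))"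

definition ell1_has_derivative_at ::
  "(nat \<Rightarrow> real) \<Rightarrow> (real \<Rightarrow> nat \<Rightarrow> real) \<Rightarrow> (nat \<Rightarrow> real) \<Rightarrow> real \<Rightarrow> bool" where
  "ell1_has_derivative_at w u v t \<longleftrightarrow>
     ell1_tendsto w (\<lambda>s n. (u s n - u t n) / (s - t)) v (at t)"


text \<open>
  Unbounded operators are represented by their graphs; the domain of an operator is
  the \<^const>\<open>Domain\<close> of its graph.
\<close>

type_synonym seq_operator = "((nat \<Rightarrow> real) \<times> (nat \<Rightarrow> real)) set"

definition op_sum :: "seq_operator \<Rightarrow> seq_operator \<Rightarrow> seq_operator" where
  "op_sum T U = {(f, \<lambda>n. g n + h n) | f g h. (f, g) \<in> T \<and> (f, h) \<in> U}"

definition op_closure :: "(nat \<Rightarrow> real) \<Rightarrow> seq_operator \<Rightarrow> seq_operator" where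
  "op_closure w T = {(f, g). f \<in> ell1 w \<and> g \<in> ell1 w \<and>
     (\<exists>F G. (\<forall>k::nat. (F k, G k) \<in> T) \<and>
        ell1_tendsto w F f sequentially \<and> ell1_tendsto w G g sequentially)}"

definition A_op :: "(nat \<Rightarrow> real) \<Rightarrow> (nat \<Rightarrow> real) \<Rightarrow> seq_operator" where
  "A_op w a = {(f, \<lambda>n. - a n * f n) | f. f \<in> ell1 w \<and> (\<lambda>n. a n * f n) \<in> ell1 w}"

definition B_seq ::
  "(nat \<Rightarrow> real) \<Rightarrow> (nat \<Rightarrow> nat \<Rightarrow> real) \<Rightarrow> (nat \<Rightarrow> real) \<Rightarrow> nat \<Rightarrow> real" where
  "B_seq a b f n =
     (if n = 0 then 0 else (\<Sum>k. a (n + 1 + k) * b n (n + 1 + k) * f (n + 1 + k)))"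

definition B_op ::
  "(nat \<Rightarrow> real) \<Rightarrow> (nat \<Rightarrow> real) \<Rightarrow> (nat \<Rightarrow> nat \<Rightarrow> real) \<Rightarrow> seq_operator" where
  "B_op w a b = {(f, B_seq a b f) | f. f \<in> ell1 w \<and>
     (\<forall>n\<ge>1. summable (\<lambda>k. a (n + 1 + k) * b n (n + 1 + k) * f (n + 1 + k))) \<and>
     B_seq a b f \<in> ell1 w}"

definition C_op :: "(nat \<Rightarrow> real) \<Rightarrow> (nat \<Rightarrow> real) \<Rightarrow> seq_operator" where
  "C_op w c = {(f, \<lambda>n. - c n * f n) | f.
     f \<in> ell1 w \<and> summable (\<lambda>n. w (Suc n) * c (Suc n) * \<bar>f (Suc n)\<bar>)}"

definition nonneg_seq :: "(nat \<Rightarrow> real) \<Rightarrow> bool" where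
  "nonneg_seq f \<longleftrightarrow> (\<forall>n\<ge>1. 0 \<le> f n)"


definition bounded_linear_ell1 ::
  "(nat \<Rightarrow> real) \<Rightarrow> ((nat \<Rightarrow> real) \<Rightarrow> nat \<Rightarrow> real) \<Rightarrow> bool" where
  "bounded_linear_ell1 w T \<longleftrightarrow>
     (\<forall>f\<in>ell1 w. T f \<in> ell1 w) \<and>
     (\<forall>f\<in>ell1 w. \<forall>g\<in>ell1 w. T (\<lambda>n. f n + g n) = (\<lambda>n. T f n + T g n)) \<and>
     (\<forall>r. \<forall>f\<in>ell1 w. T (\<lambda>n. r * f n) = (\<lambda>n. r * T f n)) \<and>
     (\<exists>K. \<forall>f\<in>ell1 w. ell1_norm w (T f) \<le> K * ell1_norm w f)"

definition C0_semigroup ::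
  "(nat \<Rightarrow> real) \<Rightarrow> (real \<Rightarrow> (nat \<Rightarrow> real) \<Rightarrow> nat \<Rightarrow> real) \<Rightarrow> bool" where
  "C0_semigroup w S \<longleftrightarrow>
     (\<forall>t\<ge>0. bounded_linear_ell1 w (S t)) \<and>
     (\<forall>f\<in>ell1 w. S 0 f = f) \<and>
     (\<forall>s\<ge>0. \<forall>t\<ge>0. \<forall>f\<in>ell1 w. S (s + t) f = S s (S t f)) \<and>
     (\<forall>f\<in>ell1 w. ell1_tendsto w (\<lambda>t. S t f) f (at_right 0))"

definition substochastic_semigroup ::
  "(nat \<Rightarrow> real) \<Rightarrow> (real \<Rightarrow> (nat \<Rightarrow> real) \<Rightarrow> nat \<Rightarrow> real) \<Rightarrow> bool" where
  "substochastic_semigroup w S \<longleftrightarrow> C0_semigroup w S \<and>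
     (\<forall>t\<ge>0. \<forall>f\<in>ell1 w. nonneg_seq f \<longrightarrow>
        nonneg_seq (S t f) \<and> ell1_norm w (S t f) \<le> ell1_norm w f)"

definition semigroup_generator ::
  "(nat \<Rightarrow> real) \<Rightarrow> (real \<Rightarrow> (nat \<Rightarrow> real) \<Rightarrow> nat \<Rightarrow> real) \<Rightarrow> seq_operator" where
  "semigroup_generator w S = {(f, g). f \<in> ell1 w \<and> g \<in> ell1 w \<and>
     ell1_tendsto w (\<lambda>h n. (S h f n - f n) / h) g (at_right 0)}"

definition G_op ::
  "(nat \<Rightarrow> real) \<Rightarrow> (nat \<Rightarrow> real) \<Rightarrow> (nat \<Rightarrow> nat \<Rightarrow> real) \<Rightarrow> seq_operator" where
  "G_op w a b = op_closure w (op_sum (A_op w a) (B_op w a b))"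

text \<open>
  The substochastic semigroup generated by \<open>G_op w a b\<close>. A \<open>C\<^sub>0\<close>-semigroup is determined by its
  generator for times \<open>t \<ge> 0\<close> and arguments in \<open>ell1 w\<close>; the choice operator merely
  fixes irrelevant values elsewhere.
\<close>

definition frag_semigroup ::
  "(nat \<Rightarrow> real) \<Rightarrow> (nat \<Rightarrow> real) \<Rightarrow> (nat \<Rightarrow> nat \<Rightarrow> real) \<Rightarrow>
     real \<Rightarrow> (nat \<Rightarrow> real) \<Rightarrow> nat \<Rightarrow> real" where
  "frag_semigroup w a b =
     (SOME S. substochastic_semigroup w S \<and> semigroup_generator w S = G_op w a b)"


text \<open>
  Only the values \<open>u t\<close> with \<open>t \<ge> 0\<close> matter. The last conjunct is the differential equation
  \<open>u'(t) = A u(t) + B u(t)\<close>.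
\<close>

definition classical_solution ::
  "(nat \<Rightarrow> real) \<Rightarrow> (nat \<Rightarrow> real) \<Rightarrow> (nat \<Rightarrow> nat \<Rightarrow> real) \<Rightarrow> (nat \<Rightarrow> real) \<Rightarrow>
     (real \<Rightarrow> nat \<Rightarrow> real) \<Rightarrow> bool" where
  "classical_solution w a b u0 u \<longleftrightarrow>
     ell1_continuous_on w {0..} u \<and> u 0 = u0 \<and>
     (\<forall>t>0. u t \<in> Domain (A_op w a) \<inter> Domain (B_op w a b)) \<and>
     (\<exists>u'. ell1_continuous_on w {0<..} u' \<and>
        (\<forall>t>0. ell1_has_derivative_at w u (u' t) t) \<and>
        (\<forall>t>0. (u t, u' t) \<in> op_sum (A_op w a) (B_op w a b)))"

definition nonneg_solution :: "(real \<Rightarrow> nat \<Rightarrow> real) \<Rightarrow> bool" where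
  "nonneg_solution u \<longleftrightarrow> (\<forall>t\<ge>0. nonneg_seq (u t))"

definition M1 :: "(nat \<Rightarrow> real) \<Rightarrow> real" where
  "M1 f = (\<Sum>n. real (Suc n) * f (Suc n))"

definition mass_conserving :: "(nat \<Rightarrow> real) \<Rightarrow> (real \<Rightarrow> nat \<Rightarrow> real) \<Rightarrow> bool" where
  "mass_conserving u0 u \<longleftrightarrow> (\<forall>t\<ge>0. M1 (u t) = M1 u0)"

end

theory Submission
  imports Defs
begin

text \<open>
  The matrix of \<open>A + B\<close> is upper triangular, so finitely supported sequences form an invariant
  dense subspace on which the equation is a finite triangular linear system. Its solutions give a
  non-negative kernel, and \<open>\<Sum>n<j. w n * b n j \<le> w j\<close> says precisely that weighted column
  sums of the kernel do not increase in time; hence the kernel defines a substochastic semigroup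
  on \<open>ell1 w\<close>. Its generator is the closure of \<open>A + B\<close>: the domain of \<open>A\<close> is reached by
  truncation, and conversely finitely supported sequences are a core because \<open>1 - A - B\<close> maps
  them onto themselves while the generator is dissipative. Since \<open>c\<close> is non-decreasing, the weight
  \<open>w * c\<close> satisfies the same column inequality, so the semigroup leaves the domain of \<open>C\<close>, which lies
  in the domain of \<open>A\<close>, invariant; on that domain the closure acts as \<open>A + B\<close>.
  Uniqueness follows from dissipativity, and mass conservation from constancy of the column sums of
  the kernel with weight \<open>n\<close>.
\<close>

section \<open>The weighted sequence space\<close>

text \<open>No vector-valued integral occurs. Whatever would be obtained by integrating a derivative
  in \<open>ell1 w\<close> is obtained from a real function, the norm along a curve, by the
  one-sided inequality \<open>left_growth_bound\<close>; dissipativity or the triangle inequality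
  supplies its local hypothesis. \<open>frag_semigroup\<close> is given by a choice, so only its
  substochasticity and its generator are known. The kernel semigroup therefore plays two roles: it
  shows that the choice is not void, and, since the generator determines orbits starting in the
  domain of A, it gives those orbits their explicit form. Estimates for the weight
  \<open>w * c\<close> and for the mass are read off that form. The domain of A cannot simply take
  the place of the domain of C: the weight \<open>w * a\<close> need not satisfy the column
  inequality, as \<open>a\<close> need not be monotone, and \<open>c\<close> is a monotone majorant
  that repairs this. Invariance is what turns an orbit of the closure into a classical solution: a
  generator is single-valued, so at a point of the domain of A the derivative must be the value of A
  + B.\<close>

locale positive_weight =
  fixes w :: "nat \<Rightarrow> real"
  assumes w_pos: "1 \<le> n \<Longrightarrow> 0 < w n"
begin

abbreviation nrm :: "(nat \<Rightarrow> real) \<Rightarrow> real" where "nrm \<equiv> ell1_norm w"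

lemma w_nonneg: "1 \<le> n \<Longrightarrow> 0 \<le> w n"
  using w_pos by (simp add: less_imp_le)

lemma ell1_summable: "f \<in> ell1 w \<Longrightarrow> summable (\<lambda>n. w (Suc n) * \<bar>f (Suc n)\<bar>)"
  and ell1_0: "f \<in> ell1 w \<Longrightarrow> f 0 = 0"
  by (auto simp: ell1_def)

lemma ell1_zero [simp]: "(\<lambda>n. 0) \<in> ell1 w" and nrm_zero [simp]: "nrm (\<lambda>n. 0) = 0"
  by (auto simp: ell1_def ell1_norm_def)

text \<open>Two majorants, so that sums, differences and, with one majorant zero, positive and
  negative parts all come from one comparison.\<close>

lemma ell1_dominated:
  assumes "g \<in> ell1 w" and "h \<in> ell1 w" and "f 0 = 0" and le: "\<And>n. \<bar>f n\<bar> \<le> \<bar>g n\<bar> + \<bar>h n\<bar>"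
  shows "f \<in> ell1 w \<and> nrm f \<le> nrm g + nrm h"
proof -
  have sg: "summable (\<lambda>n. w (Suc n) * \<bar>g (Suc n)\<bar> + w (Suc n) * \<bar>h (Suc n)\<bar>)"
    by (intro summable_add ell1_summable assms)
  have le': "w (Suc n) * \<bar>f (Suc n)\<bar> \<le> w (Suc n) * \<bar>g (Suc n)\<bar> + w (Suc n) * \<bar>h (Suc n)\<bar>" for n
    using mult_left_mono[OF le[of "Suc n"] w_nonneg[of "Suc n"]] by (simp add: algebra_simps)
  have sf: "summable (\<lambda>n. w (Suc n) * \<bar>f (Suc n)\<bar>)"
    by (rule summable_comparison_test'[OF sg, of 0]) (use le' w_nonneg in \<open>auto simp: abs_mult\<close>)
  have "nrm f \<le> (\<Sum>n. w (Suc n) * \<bar>g (Suc n)\<bar> + w (Suc n) * \<bar>h (Suc n)\<bar>)"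
    unfolding ell1_norm_def by (rule suminf_le[OF le' sf sg])
  also have "\<dots> = nrm g + nrm h"
    unfolding ell1_norm_def using assms by (intro suminf_add[symmetric] ell1_summable)
  finally show ?thesis using sf assms by (simp add: ell1_def)
qed

lemma nrm_nonneg: "f \<in> ell1 w \<Longrightarrow> 0 \<le> nrm f"
  unfolding ell1_norm_def using w_nonneg by (intro suminf_nonneg ell1_summable) auto

lemma ell1_scale: "f \<in> ell1 w \<Longrightarrow> (\<lambda>n. r * f n) \<in> ell1 w"
  and nrm_scale: "f \<in> ell1 w \<Longrightarrow> nrm (\<lambda>n. r * f n) = \<bar>r\<bar> * nrm f"
proof -
  assume f: "f \<in> ell1 w"
  show "(\<lambda>n. r * f n) \<in> ell1 w"
    using summable_mult[OF ell1_summable[OF f], of "\<bar>r\<bar>"] ell1_0[OF f]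
    by (simp add: ell1_def abs_mult algebra_simps)
  show "nrm (\<lambda>n. r * f n) = \<bar>r\<bar> * nrm f"
    using suminf_mult[OF ell1_summable[OF f], of "\<bar>r\<bar>"]
    by (simp add: ell1_norm_def abs_mult algebra_simps)
qed

lemma ell1_divide: "f \<in> ell1 w \<Longrightarrow> (\<lambda>n. f n / r) \<in> ell1 w"
  and nrm_divide: "f \<in> ell1 w \<Longrightarrow> nrm (\<lambda>n. f n / r) = nrm f / \<bar>r\<bar>"
  using ell1_scale[of f "1/r"] nrm_scale[of f "1/r"] by auto

lemma ell1_add: "f \<in> ell1 w \<Longrightarrow> g \<in> ell1 w \<Longrightarrow> (\<lambda>n. f n + g n) \<in> ell1 w"
  and nrm_add: "f \<in> ell1 w \<Longrightarrow> g \<in> ell1 w \<Longrightarrow> nrm (\<lambda>n. f n + g n) \<le> nrm f + nrm g"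
  using ell1_dominated[of f g "\<lambda>n. f n + g n"] ell1_0[of f] ell1_0[of g] by (auto simp: abs_triangle_ineq)

lemma ell1_diff: "f \<in> ell1 w \<Longrightarrow> g \<in> ell1 w \<Longrightarrow> (\<lambda>n. f n - g n) \<in> ell1 w"
  and nrm_diff: "f \<in> ell1 w \<Longrightarrow> g \<in> ell1 w \<Longrightarrow> nrm (\<lambda>n. f n - g n) \<le> nrm f + nrm g"
  using ell1_dominated[of f g "\<lambda>n. f n - g n"] ell1_0[of f] ell1_0[of g] by (auto simp: abs_triangle_ineq4)

lemma nrm_minus_commute: "nrm (\<lambda>n. f n - g n) = nrm (\<lambda>n. g n - f n)"
  by (simp add: ell1_norm_def abs_minus_commute)

lemma nrm_triangle3:
  assumes "f \<in> ell1 w" "g \<in> ell1 w" "h \<in> ell1 w"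
  shows "nrm (\<lambda>n. f n - h n) \<le> nrm (\<lambda>n. f n - g n) + nrm (\<lambda>n. g n - h n)"
  using nrm_add[OF ell1_diff[OF assms(1,2)] ell1_diff[OF assms(2,3)]] by simp

lemma nrm_reverse_triangle:
  assumes "f \<in> ell1 w" "g \<in> ell1 w"
  shows "\<bar>nrm f - nrm g\<bar> \<le> nrm (\<lambda>n. f n - g n)"
  using nrm_triangle3[OF assms(1,2) ell1_zero] nrm_triangle3[OF assms(2,1) ell1_zero]
    nrm_minus_commute[of f g] by simp

lemma coordinate_le_nrm:
  assumes "f \<in> ell1 w" "1 \<le> n"
  shows "w n * \<bar>f n\<bar> \<le> nrm f"
proof -
  have "sum (\<lambda>n. w (Suc n) * \<bar>f (Suc n)\<bar>) {n - 1} \<le> (\<Sum>n. w (Suc n) * \<bar>f (Suc n)\<bar>)"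
    using w_nonneg by (intro sum_le_suminf ell1_summable assms) auto
  then show ?thesis using assms(2) by (simp add: ell1_norm_def)
qed

lemma nrm_le_0_imp_eq_0:
  assumes "f \<in> ell1 w" "nrm f \<le> 0"
  shows "f = (\<lambda>n. 0)"
proof
  fix n
  show "f n = 0"
  proof (cases "n = 0")
    case False
    then have "w n * \<bar>f n\<bar> \<le> 0" using coordinate_le_nrm[OF assms(1), of n] assms(2) by simp
    with w_pos[of n] False show ?thesis by (simp add: mult_le_0_iff)
  qed (use ell1_0 assms in simp)
qed

lemma nrm_diff_le_0_imp_eq:
  assumes "f \<in> ell1 w" "g \<in> ell1 w" "nrm (\<lambda>n. f n - g n) \<le> 0"
  shows "f = g"
  using nrm_le_0_imp_eq_0[OF ell1_diff[OF assms(1,2)] assms(3)] by (auto simp: fun_eq_iff)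

lemma ell1_tendstoI_le:
  assumes "eventually (\<lambda>x. nrm (\<lambda>n. X x n - f n) \<le> g x) F"
    and "(g \<longlongrightarrow> 0) F" and "eventually (\<lambda>x. X x \<in> ell1 w) F" and "f \<in> ell1 w"
  shows "ell1_tendsto w X f F"
  unfolding ell1_tendsto_def
  by (rule tendsto_sandwich[OF _ assms(1) tendsto_const assms(2)])
    (use assms(3) in \<open>eventually_elim, auto intro: nrm_nonneg ell1_diff assms(4)\<close>)

lemma ell1_tendsto_unique:
  assumes "ell1_tendsto w X f F" "ell1_tendsto w X g F" "eventually (\<lambda>x. X x \<in> ell1 w) F"
    and "f \<in> ell1 w" "g \<in> ell1 w" "F \<noteq> bot"
  shows "f = g"
proof (rule nrm_diff_le_0_imp_eq)
  have "((\<lambda>x. nrm (\<lambda>n. X x n - f n) + nrm (\<lambda>n. X x n - g n)) \<longlongrightarrow> 0 + 0) F"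
    using assms(1,2) unfolding ell1_tendsto_def by (rule tendsto_add)
  moreover have "eventually (\<lambda>x. nrm (\<lambda>n. f n - g n)
      \<le> nrm (\<lambda>n. X x n - f n) + nrm (\<lambda>n. X x n - g n)) F"
    using assms(3)
  proof eventually_elim
    case (elim x)
    show ?case
      using nrm_triangle3[OF assms(4) elim assms(5)] nrm_minus_commute[of f "X x"] by simp
  qed
  ultimately show "nrm (\<lambda>n. f n - g n) \<le> 0"
    using tendsto_lowerbound[OF _ _ assms(6)] by fastforce
qed (use assms in auto)

lemma ell1_tendsto_diff:
  assumes "ell1_tendsto w X f F" "ell1_tendsto w Y g F"
    and "eventually (\<lambda>x. X x \<in> ell1 w) F" "eventually (\<lambda>x. Y x \<in> ell1 w) F"
    and "f \<in> ell1 w" "g \<in> ell1 w"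
  shows "ell1_tendsto w (\<lambda>x n. X x n - Y x n) (\<lambda>n. f n - g n) F"
proof (rule ell1_tendstoI_le)
  show "((\<lambda>x. nrm (\<lambda>n. X x n - f n) + nrm (\<lambda>n. Y x n - g n)) \<longlongrightarrow> 0) F"
    using tendsto_add[OF assms(1,2)[unfolded ell1_tendsto_def]] by simp
  show "eventually (\<lambda>x. nrm (\<lambda>n. X x n - Y x n - (f n - g n))
      \<le> nrm (\<lambda>n. X x n - f n) + nrm (\<lambda>n. Y x n - g n)) F"
    using assms(3,4)
  proof eventually_elim
    case (elim x)
    then show ?case
      using nrm_diff[OF ell1_diff[OF elim(1) assms(5)] ell1_diff[OF elim(2) assms(6)]]
      by (simp add: algebra_simps)
  qed
  show "eventually (\<lambda>x. (\<lambda>n. X x n - Y x n) \<in> ell1 w) F"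
    using assms(3,4) by eventually_elim (rule ell1_diff)
qed (use assms ell1_diff in auto)

lemma ell1_tendsto_norm:
  assumes "ell1_tendsto w X f F" "eventually (\<lambda>x. X x \<in> ell1 w) F" "f \<in> ell1 w"
  shows "((\<lambda>x. nrm (X x)) \<longlongrightarrow> nrm f) F"
proof (rule LIM_zero_cancel, rule Lim_null_comparison)
  show "eventually (\<lambda>x. norm (nrm (X x) - nrm f) \<le> nrm (\<lambda>n. X x n - f n)) F"
    using assms(2) by eventually_elim (use nrm_reverse_triangle assms(3) in auto)
qed (use assms(1) in \<open>simp add: ell1_tendsto_def\<close>)

end

text \<open>A mean value inequality for functions such as a norm along a curve, which need not be
  differentiable. The growth bound looks backwards from each point because dissipativity compares a
  point with an earlier one; the slack \<epsilon> absorbs the error of a difference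
  quotient.\<close>

lemma left_growth_bound:
  fixes \<phi> :: "real \<Rightarrow> real"
  assumes "0 \<le> T" and cont: "continuous_on {0..T} \<phi>"
    and growth: "\<And>s \<epsilon>. 0 < s \<Longrightarrow> s \<le> T \<Longrightarrow> 0 < \<epsilon> \<Longrightarrow>
      eventually (\<lambda>h. \<phi> s \<le> \<phi> (s - h) + h * (M + \<epsilon>)) (at_right 0)"
  shows "\<phi> T \<le> \<phi> 0 + T * M"
proof -
  have bound: "\<phi> T \<le> \<phi> 0 + T * (M + \<epsilon>)" if "0 < \<epsilon>" for \<epsilon>
  proof -
    define \<psi> where "\<psi> s = \<phi> s - s * (M + \<epsilon>)" for s
    \<comment> \<open>The points where \<psi> is at least its final value. The least of them is 0,
      since from a positive one the local bound would lead further to the left.\<close>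
    define Z where "Z = {s \<in> {0..T}. \<psi> T \<le> \<psi> s}"
    have "continuous_on {0..T} \<psi>" unfolding \<psi>_def by (intro continuous_intros cont)
    then have "closed Z" unfolding Z_def
      by (intro continuous_on_closed_Collect_le) (auto intro: continuous_intros)
    moreover have "T \<in> Z" using \<open>0 \<le> T\<close> by (simp add: Z_def)
    moreover have bdd: "bdd_below Z" by (auto simp: Z_def bdd_below_def)
    ultimately have inf: "Inf Z \<in> Z" using closed_contains_Inf by blast
    have "Inf Z = 0"
    proof (rule ccontr)
      assume "Inf Z \<noteq> 0"
      with inf have pos: "0 < Inf Z" "Inf Z \<le> T" by (auto simp: Z_def)
      have "eventually (\<lambda>h. 0 < h \<and> h < Inf Z) (at_right 0)"
        using pos(1) by (auto simp: eventually_at_right_field)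
      with growth[OF pos that]
      have "eventually (\<lambda>h. 0 < h \<and> h < Inf Z \<and> \<phi> (Inf Z) \<le> \<phi> (Inf Z - h) + h * (M + \<epsilon>)) (at_right 0)"
        by eventually_elim auto
      then obtain h where h: "0 < h" "h < Inf Z" "\<phi> (Inf Z) \<le> \<phi> (Inf Z - h) + h * (M + \<epsilon>)"
        using eventually_happens'[OF trivial_limit_at_right_real] by blast
      have "\<psi> (Inf Z) \<le> \<psi> (Inf Z - h)" using h(3) by (simp add: \<psi>_def algebra_simps)
      with inf h pos have "Inf Z - h \<in> Z" by (auto simp: Z_def)
      with cInf_lower[OF _ bdd] h(1) show False by fastforce
    qed
    with inf show ?thesis by (simp add: Z_def \<psi>_def algebra_simps)
  qed
  show ?thesis
  proof (rule tendsto_lowerbound)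
    show "((\<lambda>\<epsilon>. \<phi> 0 + T * (M + \<epsilon>)) \<longlongrightarrow> \<phi> 0 + T * M) (at_right 0)"
      by (auto intro!: tendsto_eq_intros)
    show "eventually (\<lambda>\<epsilon>. \<phi> T \<le> \<phi> 0 + T * (M + \<epsilon>)) (at_right 0)"
      using bound by (auto simp: eventually_at_right_field intro!: exI[of _ 1])
  qed simp
qed

section \<open>Contraction semigroups\<close>

text \<open>Strong continuity and the generator are stated at 0 from the right; composition with the
  distance to \<open>t\<close> carries them to two-sided limits at \<open>t\<close>.\<close>

lemma filterlim_abs_diff_at_right_0:
  "filterlim (\<lambda>s. \<bar>s - t\<bar>) (at_right 0) (at t within A)" for t :: real
proof -
  have "((\<lambda>s. \<bar>s - t\<bar>) \<longlongrightarrow> 0) (at t within A)"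
    by (auto intro!: tendsto_eq_intros)
  moreover have "eventually (\<lambda>s. \<bar>s - t\<bar> \<in> {0<..}) (at t within A)"
    by (auto simp: eventually_at intro!: exI[of _ 1])
  ultimately show ?thesis by (simp add: filterlim_at_right_to_0 tendsto_imp_filterlim_at_right)
qed

text \<open>Assumes only what can be verified for both instances, the explicit kernel semigroup and
  the chosen \<open>frag_semigroup\<close>, so that the two can be compared.\<close>

locale contraction_semigroup = positive_weight +
  fixes S :: "real \<Rightarrow> (nat \<Rightarrow> real) \<Rightarrow> nat \<Rightarrow> real"
  assumes C0: "C0_semigroup w S"
    and contr: "0 \<le> t \<Longrightarrow> f \<in> ell1 w \<Longrightarrow> nrm (S t f) \<le> nrm f"
begin

abbreviation gen where "gen \<equiv> semigroup_generator w S"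

lemma S_ell1: "0 \<le> t \<Longrightarrow> f \<in> ell1 w \<Longrightarrow> S t f \<in> ell1 w"
  and S_0: "f \<in> ell1 w \<Longrightarrow> S 0 f = f"
  and S_plus: "0 \<le> s \<Longrightarrow> 0 \<le> t \<Longrightarrow> f \<in> ell1 w \<Longrightarrow> S (s + t) f = S s (S t f)"
  and S_add: "0 \<le> t \<Longrightarrow> f \<in> ell1 w \<Longrightarrow> g \<in> ell1 w \<Longrightarrow> S t (\<lambda>n. f n + g n) = (\<lambda>n. S t f n + S t g n)"
  and S_scale: "0 \<le> t \<Longrightarrow> f \<in> ell1 w \<Longrightarrow> S t (\<lambda>n. r * f n) = (\<lambda>n. r * S t f n)"
  and S_at_0: "f \<in> ell1 w \<Longrightarrow> ell1_tendsto w (\<lambda>t. S t f) f (at_right 0)"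
  using C0 unfolding C0_semigroup_def bounded_linear_ell1_def by blast+

lemma S_divide: "0 \<le> t \<Longrightarrow> f \<in> ell1 w \<Longrightarrow> S t (\<lambda>n. f n / r) = (\<lambda>n. S t f n / r)"
  using S_scale[of t f "1 / r"] by simp

lemma S_diff:
  assumes "0 \<le> t" "f \<in> ell1 w" "g \<in> ell1 w"
  shows "S t (\<lambda>n. f n - g n) = (\<lambda>n. S t f n - S t g n)"
  using S_add[OF assms(1,2) ell1_scale[OF assms(3), of "-1"]] S_scale[OF assms(1,3), of "-1"]
  by simp

lemma S_diff_contr:
  assumes "0 \<le> t" "f \<in> ell1 w" "g \<in> ell1 w"
  shows "nrm (\<lambda>n. S t f n - S t g n) \<le> nrm (\<lambda>n. f n - g n)"
  using contr[OF assms(1) ell1_diff[OF assms(2,3)]] S_diff[OF assms] by simp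

text \<open>The operator at the smaller of the two times is a common factor and is contracted
  away.\<close>

lemma S_time_diff:
  assumes "0 \<le> s" "0 \<le> t" "f \<in> ell1 w"
  shows "nrm (\<lambda>n. S s f n - S t f n) \<le> nrm (\<lambda>n. S \<bar>s - t\<bar> f n - f n)"
proof -
  have *: "nrm (\<lambda>n. S s f n - S t f n) \<le> nrm (\<lambda>n. S \<bar>s - t\<bar> f n - f n)"
    if "0 \<le> t" "t \<le> s" for s t
    using S_plus[OF that(1), of "s - t" f] S_diff_contr[OF that(1), of "S (s - t) f" f]
      that assms(3) S_ell1[of "s - t" f] by simp
  show ?thesis
    using *[of t s] *[of s t] assms nrm_minus_commute[of "S s f" "S t f"]
    by (cases "t \<le> s") (auto simp: abs_minus_commute)
qed

lemma S_continuous: "f \<in> ell1 w \<Longrightarrow> ell1_continuous_on w {0..} (\<lambda>t. S t f)"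
proof -
  assume f: "f \<in> ell1 w"
  have "ell1_tendsto w (\<lambda>s. S s f) (S t f) (at t within {0..})" if "0 \<le> t" for t
  proof (rule ell1_tendstoI_le)
    show "((\<lambda>s. nrm (\<lambda>n. S \<bar>s - t\<bar> f n - f n)) \<longlongrightarrow> 0) (at t within {0..})"
      using filterlim_compose[OF S_at_0[OF f, unfolded ell1_tendsto_def] filterlim_abs_diff_at_right_0] .
    show "eventually (\<lambda>s. nrm (\<lambda>n. S s f n - S t f n) \<le> nrm (\<lambda>n. S \<bar>s - t\<bar> f n - f n)) (at t within {0..})"
      and "eventually (\<lambda>s. S s f \<in> ell1 w) (at t within {0..})"
      using S_time_diff that f S_ell1 by (auto simp: eventually_at intro!: exI[of _ 1])
  qed (use that f S_ell1 in auto)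
  then show ?thesis using f S_ell1 by (auto simp: ell1_continuous_on_def)
qed

lemma gen_ell1: "(f, g) \<in> gen \<Longrightarrow> f \<in> ell1 w" "(f, g) \<in> gen \<Longrightarrow> g \<in> ell1 w"
  and gen_tendsto: "(f, g) \<in> gen \<Longrightarrow> ell1_tendsto w (\<lambda>h n. (S h f n - f n) / h) g (at_right 0)"
  by (auto simp: semigroup_generator_def)

lemma quotient_ell1: "0 \<le> h \<Longrightarrow> f \<in> ell1 w \<Longrightarrow> (\<lambda>n. (S h f n - f n) / h) \<in> ell1 w"
  by (intro ell1_divide ell1_diff S_ell1)

lemma eventually_at_right_0: "eventually (\<lambda>h::real. 0 < h) (at_right 0)"
  by (simp add: eventually_at_right_less)

lemma gen_functional:
  assumes "(f, g) \<in> gen" "(f, g') \<in> gen" shows "g = g'"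
  by (rule ell1_tendsto_unique[OF gen_tendsto[OF assms(1)] gen_tendsto[OF assms(2)]])
    (use assms gen_ell1 quotient_ell1 in \<open>auto intro!: eventually_mono[OF eventually_at_right_0]\<close>)

lemma gen_invariant:
  assumes fg: "(f, g) \<in> gen" and t: "0 \<le> t" shows "(S t f, S t g) \<in> gen"
proof -
  note fe = gen_ell1[OF fg]
  have "ell1_tendsto w (\<lambda>h n. (S h (S t f) n - S t f n) / h) (S t g) (at_right 0)"
  proof (rule ell1_tendstoI_le)
    show "((\<lambda>h. nrm (\<lambda>n. (S h f n - f n) / h - g n)) \<longlongrightarrow> 0) (at_right 0)"
      using gen_tendsto[OF fg] by (simp add: ell1_tendsto_def)
    show "eventually (\<lambda>h. nrm (\<lambda>n. (S h (S t f) n - S t f n) / h - S t g n)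
        \<le> nrm (\<lambda>n. (S h f n - f n) / h - g n)) (at_right 0)"
      using eventually_at_right_0
    proof eventually_elim
      case (elim h)
      have "S h (S t f) = S t (S h f)"
        using S_plus[of h t f] S_plus[of t h f] elim t fe by (simp add: add.commute)
      moreover have "S t (\<lambda>n. (S h f n - f n) / h) = (\<lambda>n. (S t (S h f) n - S t f n) / h)"
        using elim t fe by (simp add: S_divide ell1_diff S_diff S_ell1)
      ultimately show ?case
        using S_diff_contr[OF t quotient_ell1[of h f] fe(2)] elim fe by simp
    qed
    show "eventually (\<lambda>h. (\<lambda>n. (S h (S t f) n - S t f n) / h) \<in> ell1 w) (at_right 0)"
      using eventually_at_right_0 by eventually_elim (use quotient_ell1 S_ell1 fe t in auto)
  qed (use S_ell1 fe t in auto)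
  then show ?thesis using fe S_ell1 t by (auto simp: semigroup_generator_def)
qed

text \<open>With \<open>m = min s t\<close> and \<open>h\<close> the distance of the times,
  quotients on either side of \<open>t\<close> take the single form \<open>S m (D h)\<close>. On the
  left \<open>S m g\<close> is not yet the limit \<open>S t g\<close>; the second summand of
  \<open>?r\<close> pays for this.\<close>

lemma S_has_derivative:
  assumes fg: "(f, g) \<in> gen" and t: "0 < t"
  shows "ell1_has_derivative_at w (\<lambda>s. S s f) (S t g) t"
  unfolding ell1_has_derivative_at_def
proof (rule ell1_tendstoI_le)
  note fe = gen_ell1[OF fg]
  define D where "D h n = (S h f n - f n) / h" for h n
  have D_ell1: "D h \<in> ell1 w" if "0 < h" for h
    using quotient_ell1[of h f] that fe by (simp add: D_def[abs_def])
  let ?r = "\<lambda>h. nrm (\<lambda>n. D h n - g n) + nrm (\<lambda>n. S h g n - g n)"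
  have "(?r \<longlongrightarrow> 0 + 0) (at_right 0)"
    using gen_tendsto[OF fg] S_at_0[OF fe(2)] unfolding D_def
    by (intro tendsto_add) (auto simp: ell1_tendsto_def)
  from filterlim_compose[OF this filterlim_abs_diff_at_right_0]
  show "((\<lambda>s. ?r \<bar>s - t\<bar>) \<longlongrightarrow> 0) (at t)" by simp
  have ev: "eventually (\<lambda>s. 0 < s \<and> s \<noteq> t) (at t)"
    using t by (auto simp: eventually_at intro!: exI[of _ t] simp: dist_real_def)
  have step: "S r (D h) = (\<lambda>n. (S (r + h) f n - S r f n) / h)" if "0 \<le> r" "0 < h" for r h
    using that fe unfolding D_def by (simp add: S_divide ell1_diff S_diff S_ell1 S_plus)
  show "eventually (\<lambda>s. nrm (\<lambda>n. (S s f n - S t f n) / (s - t) - S t g n) \<le> ?r \<bar>s - t\<bar>) (at t)"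
    using ev
  proof eventually_elim
    case (elim s)
    define m h where "m = min s t" and "h = \<bar>s - t\<bar>"
    have mh: "0 \<le> m" "0 < h" using elim t by (auto simp: m_def h_def)
    have *: "(S s f n - S t f n) / (s - t) = S m (D h) n" for n
    proof (cases "t \<le> s")
      case True
      then show ?thesis using step[OF mh] by (simp add: m_def h_def)
    next
      case False
      then show ?thesis using step[OF mh] elim
        by (simp add: m_def h_def fun_eq_iff) (simp add: divide_simps, simp add: algebra_simps)
    qed
    moreover have "nrm (\<lambda>n. S m (D h) n - S t g n)
        \<le> nrm (\<lambda>n. S m (D h) n - S m g n) + nrm (\<lambda>n. S m g n - S t g n)"
      using mh t fe D_ell1 by (intro nrm_triangle3 S_ell1) auto
    moreover have "nrm (\<lambda>n. S m (D h) n - S m g n) \<le> nrm (\<lambda>n. D h n - g n)"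
      using S_diff_contr mh fe D_ell1 by simp
    moreover have "nrm (\<lambda>n. S m g n - S t g n) \<le> nrm (\<lambda>n. S h g n - g n)"
    proof (cases "t \<le> s")
      case True
      then show ?thesis using nrm_nonneg[OF ell1_diff[OF S_ell1[of h g] fe(2)]] mh fe
        by (simp add: m_def)
    next
      case False
      then show ?thesis using S_time_diff[of m t g] mh t fe by (simp add: m_def h_def)
    qed
    ultimately show ?case unfolding * h_def by linarith
  qed
  show "eventually (\<lambda>s. (\<lambda>n. (S s f n - S t f n) / (s - t)) \<in> ell1 w) (at t)"
    using ev by eventually_elim (use t fe in \<open>auto intro!: ell1_divide ell1_diff S_ell1\<close>)
  show "S t g \<in> ell1 w" using S_ell1 t fe by simp
qed

text \<open>For the difference quotient \<open>D h\<close> one has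
  \<open>(1 + l/h) f = (f - l D h) + (l/h) S h f\<close>. In norm, contractivity cancels the last
  term against the \<open>l/h\<close> on the left; this is the claim with \<open>D h\<close> in
  place of \<open>g\<close>, and \<open>h\<close> then tends to 0.\<close>

lemma gen_dissipative:
  assumes fg: "(f, g) \<in> gen" and l: "0 \<le> l"
  shows "nrm f \<le> nrm (\<lambda>n. f n - l * g n)"
proof -
  note fe = gen_ell1[OF fg]
  define D where "D h n = (S h f n - f n) / h" for h n
  have D_ell1: "D h \<in> ell1 w" if "0 < h" for h
    using quotient_ell1[of h f] that fe by (simp add: D_def[abs_def])
  have "((\<lambda>h. l * nrm (\<lambda>n. D h n - g n)) \<longlongrightarrow> l * 0) (at_right 0)"
    using gen_tendsto[OF fg] unfolding D_def by (intro tendsto_mult) (auto simp: ell1_tendsto_def)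
  moreover have "eventually (\<lambda>h. nrm f - nrm (\<lambda>n. f n - l * g n) \<le> l * nrm (\<lambda>n. D h n - g n)) (at_right 0)"
    using eventually_at_right_0
  proof eventually_elim
    case (elim h)
    have fD: "f n = ((f n - l * D h n) + (l / h) * S h f n) / (1 + l / h)" for n
      using elim l unfolding D_def by (simp add: divide_simps) (simp add: algebra_simps add_nonneg_pos)
    have e1: "(\<lambda>n. f n - l * D h n) \<in> ell1 w" and e2: "(\<lambda>n. (l / h) * S h f n) \<in> ell1 w"
      using elim fe D_ell1 by (intro ell1_diff ell1_scale S_ell1; simp)+
    have "(1 + l / h) * nrm f = nrm (\<lambda>n. (f n - l * D h n) + (l / h) * S h f n)"
      using nrm_scale[OF fe(1), of "1 + l / h"] elim l
      by (subst (asm) fD) (simp add: add_nonneg_eq_0_iff)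
    also have "\<dots> \<le> nrm (\<lambda>n. f n - l * D h n) + (l / h) * nrm f"
      using nrm_add[OF e1 e2] nrm_scale[OF S_ell1[of h f], of "l / h"] elim l fe
        mult_left_mono[OF contr[of h f], of "l / h"] by simp
    finally have "nrm f \<le> nrm (\<lambda>n. f n - l * D h n)" by (simp add: algebra_simps)
    also have "\<dots> \<le> nrm (\<lambda>n. (f n - l * g n)) + nrm (\<lambda>n. l * (D h n - g n))"
      using nrm_diff[OF ell1_diff[OF fe(1) ell1_scale[OF fe(2), of l]]
          ell1_scale[OF ell1_diff[OF D_ell1[OF elim] fe(2)], of l]]
      by (simp add: algebra_simps)
    finally show ?case
      using nrm_scale[OF ell1_diff[OF D_ell1[OF elim] fe(2)], of l] l by simp
  qed
  ultimately have "nrm f - nrm (\<lambda>n. f n - l * g n) \<le> l * 0"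
    by (intro tendsto_lowerbound[where F = "at_right 0"]) auto
  then show ?thesis by simp
qed

lemma gen_diff:
  assumes "(f, g) \<in> gen" "(f', g') \<in> gen"
  shows "(\<lambda>n. f n - f' n, \<lambda>n. g n - g' n) \<in> gen"
proof -
  note e = gen_ell1[OF assms(1)] gen_ell1[OF assms(2)]
  have "ell1_tendsto w (\<lambda>h n. (S h f n - f n) / h - (S h f' n - f' n) / h) (\<lambda>n. g n - g' n) (at_right 0)"
    using e by (intro ell1_tendsto_diff gen_tendsto assms)
      (auto intro!: eventually_mono[OF eventually_at_right_0] quotient_ell1)
  moreover have "eventually (\<lambda>h. (\<lambda>n. (S h f n - f n) / h - (S h f' n - f' n) / h) =
      (\<lambda>n. (S h (\<lambda>n. f n - f' n) n - (f n - f' n)) / h)) (at_right 0)"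
    using eventually_at_right_0
    by eventually_elim (use e in \<open>simp add: S_diff fun_eq_iff diff_divide_distrib\<close>)
  ultimately have "ell1_tendsto w (\<lambda>h n. (S h (\<lambda>n. f n - f' n) n - (f n - f' n)) / h)
      (\<lambda>n. g n - g' n) (at_right 0)"
    unfolding ell1_tendsto_def
    by (elim Lim_transform_eventually eventually_mono) (simp add: fun_eq_iff)
  then show ?thesis using e by (auto simp: semigroup_generator_def ell1_diff)
qed

end

section \<open>Uniqueness of orbits and closedness of the generator\<close>

context positive_weight begin

lemma continuous_on_nrm:
  assumes "ell1_continuous_on w I u"
  shows "continuous_on I (\<lambda>t. nrm (u t))"
  using assms unfolding continuous_on_def ell1_continuous_on_def
  by (auto intro!: ell1_tendsto_norm simp: eventually_at intro!: exI[of _ 1])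

lemma ell1_continuous_on_diff:
  assumes "ell1_continuous_on w I u" "ell1_continuous_on w I v"
  shows "ell1_continuous_on w I (\<lambda>t n. u t n - v t n)"
  using assms unfolding ell1_continuous_on_def
  by (auto intro!: ell1_tendsto_diff ell1_diff simp: eventually_at intro!: exI[of _ 1])

lemma ell1_has_derivative_at_diff:
  assumes "ell1_has_derivative_at w u u' t" "ell1_has_derivative_at w v v' t"
    and "u' \<in> ell1 w" "v' \<in> ell1 w" "0 < t" "\<And>s. 0 \<le> s \<Longrightarrow> u s \<in> ell1 w" "\<And>s. 0 \<le> s \<Longrightarrow> v s \<in> ell1 w"
  shows "ell1_has_derivative_at w (\<lambda>s n. u s n - v s n) (\<lambda>n. u' n - v' n) t"
proof -
  have ev: "eventually (\<lambda>s. 0 < s) (at t)"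
    using \<open>0 < t\<close> by (auto simp: eventually_at intro!: exI[of _ t] simp: dist_real_def)
  have "ell1_tendsto w (\<lambda>s n. (u s n - u t n) / (s - t) - (v s n - v t n) / (s - t)) (\<lambda>n. u' n - v' n) (at t)"
    using assms ev unfolding ell1_has_derivative_at_def
    by (intro ell1_tendsto_diff)
      (auto elim!: eventually_mono intro!: ell1_divide ell1_diff)
  then show ?thesis
    by (simp add: ell1_has_derivative_at_def diff_divide_distrib[symmetric] algebra_simps)
qed

text \<open>Increments are taken backwards from \<open>t\<close>, the form in which
  \<open>left_growth_bound\<close> consumes a derivative.\<close>

lemma left_quotient_eventually:
  assumes "ell1_has_derivative_at w u u' t" and "0 < \<epsilon>"
  shows "eventually (\<lambda>h. nrm (\<lambda>n. (u t n - u (t - h) n) / h - u' n) < \<epsilon>) (at_right 0)"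
proof -
  have "filterlim (\<lambda>h. t - h) (at t) (at_right 0)"
    unfolding filterlim_at
    by (auto intro!: tendsto_eq_intros simp: eventually_at_right_less eventually_at_filter)
  from filterlim_compose[OF assms(1)[unfolded ell1_has_derivative_at_def ell1_tendsto_def] this]
  have "((\<lambda>h. nrm (\<lambda>n. (u (t - h) n - u t n) / - h - u' n)) \<longlongrightarrow> 0) (at_right 0)" by simp
  from order_tendstoD(2)[OF this assms(2)] show ?thesis
    by eventually_elim (simp add: minus_divide_left[symmetric] diff_divide_distrib)
qed

end

context contraction_semigroup begin

text \<open>The difference \<open>d\<close> to the orbit solves the equation with initial value 0.
  Dissipativity with \<open>l = h\<close> is a backward Euler step: the norm of \<open>d s\<close>
  is at most that of \<open>d s - h d' s\<close>, which is \<open>d (s - h)\<close> up to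
  \<open>o(h)\<close>. So the norm cannot grow.\<close>

lemma gen_solution_unique:
  assumes cont: "ell1_continuous_on w {0..} v"
    and der: "\<And>t. 0 < t \<Longrightarrow> ell1_has_derivative_at w v (v' t) t"
    and eq: "\<And>t. 0 < t \<Longrightarrow> (v t, v' t) \<in> gen"
    and init: "(v 0, g) \<in> gen" and T: "0 \<le> T"
  shows "v T = S T (v 0)"
proof -
  define d where "d t n = v t n - S t (v 0) n" for t n
  define d' where "d' t n = v' t n - S t g n" for t n
  note e0 = gen_ell1[OF init]
  have v_ell1: "0 \<le> t \<Longrightarrow> v t \<in> ell1 w" for t
    using cont by (auto simp: ell1_continuous_on_def)
  have d_ell1: "0 \<le> t \<Longrightarrow> d t \<in> ell1 w" for t
    unfolding d_def using v_ell1 e0 by (intro ell1_diff S_ell1) auto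
  have d_cont: "continuous_on {0..} (\<lambda>t. nrm (d t))"
    unfolding d_def using cont S_continuous[OF e0(1)]
    by (intro continuous_on_nrm ell1_continuous_on_diff)
  have d_der: "ell1_has_derivative_at w d (d' t) t" if "0 < t" for t
    unfolding d_def d'_def
    using der[OF that] S_has_derivative[OF init that] gen_ell1[OF eq[OF that]] that v_ell1 e0 S_ell1
    by (intro ell1_has_derivative_at_diff) auto
  have d_gen: "(d t, d' t) \<in> gen" if "0 < t" for t
    unfolding d_def d'_def using gen_diff[OF eq[OF that] gen_invariant[OF init]] that by simp
  have "nrm (d T) \<le> nrm (d 0) + T * 0"
  proof (rule left_growth_bound[OF T])
    fix s \<epsilon> :: real assume s: "0 < s" "s \<le> T" and "0 < \<epsilon>"
    have "eventually (\<lambda>h. 0 < h \<and> h < s) (at_right 0)"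
      using s(1) by (auto simp: eventually_at_right_field)
    with left_quotient_eventually[OF d_der[OF s(1)] \<open>0 < \<epsilon>\<close>]
    show "eventually (\<lambda>h. nrm (d s) \<le> nrm (d (s - h)) + h * (0 + \<epsilon>)) (at_right 0)"
    proof eventually_elim
      case (elim h)
      let ?q = "\<lambda>n. (d s n - d (s - h) n) / h - d' s n"
      have q: "?q \<in> ell1 w"
        using elim s d_ell1 gen_ell1[OF d_gen[OF s(1)]] by (intro ell1_diff ell1_divide) auto
      have "nrm (d s) \<le> nrm (\<lambda>n. d s n - h * d' s n)"
        using gen_dissipative[OF d_gen[OF s(1)]] elim by simp
      also have "(\<lambda>n. d s n - h * d' s n) = (\<lambda>n. d (s - h) n + h * ?q n)"
        using elim by (auto simp: fun_eq_iff field_simps)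
      also have "nrm \<dots> \<le> nrm (d (s - h)) + h * nrm ?q"
        using nrm_add[OF d_ell1[of "s - h"] ell1_scale[OF q, of h]] nrm_scale[OF q, of h] elim by simp
      also have "\<dots> \<le> nrm (d (s - h)) + h * (0 + \<epsilon>)" using elim by simp
      finally show ?case .
    qed
  qed (use continuous_on_subset[OF d_cont] in auto)
  moreover have "d 0 = (\<lambda>n. 0)" using S_0 e0 by (simp add: d_def fun_eq_iff)
  ultimately have "nrm (\<lambda>n. v T n - S T (v 0) n) \<le> 0" by (simp add: d_def[abs_def])
  with v_ell1 T e0 S_ell1 show ?thesis by (intro nrm_diff_le_0_imp_eq) auto
qed

text \<open>Stands in for the formula expressing \<open>S T f - f\<close> as the integral of
  \<open>S s g\<close>: the remainder has derivative \<open>S s g - g\<close>, so its norm grows at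
  rate at most \<open>M\<close>.\<close>

lemma orbit_remainder_bound:
  assumes fg: "(f, g) \<in> gen" and T: "0 \<le> T"
    and M: "\<And>s. 0 < s \<Longrightarrow> s \<le> T \<Longrightarrow> nrm (\<lambda>n. S s g n - g n) \<le> M"
  shows "nrm (\<lambda>n. S T f n - f n - T * g n) \<le> T * M"
proof -
  note fe = gen_ell1[OF fg]
  define r where "r t n = S t f n - f n - t * g n" for t n
  have r_ell1: "0 \<le> t \<Longrightarrow> r t \<in> ell1 w" for t
    unfolding r_def using fe by (intro ell1_diff S_ell1 ell1_scale)
  have "nrm (r T) \<le> nrm (r 0) + T * M"
  proof (rule left_growth_bound[OF T])
    have "ell1_tendsto w (\<lambda>s n. s * g n) (\<lambda>n. t * g n) (at t within {0..})" for t
    proof (rule ell1_tendstoI_le)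
      show "((\<lambda>s. \<bar>s - t\<bar> * nrm g) \<longlongrightarrow> 0) (at t within {0..})" by (auto intro!: tendsto_eq_intros)
      show "eventually (\<lambda>s. nrm (\<lambda>n. s * g n - t * g n) \<le> \<bar>s - t\<bar> * nrm g) (at t within {0..})"
        using nrm_scale[OF fe(2)] by (simp add: left_diff_distrib[symmetric])
    qed (use fe ell1_scale in auto)
    then have c: "ell1_continuous_on w {0..} (\<lambda>s n. s * g n)"
      using fe ell1_scale by (auto simp: ell1_continuous_on_def)
    have "ell1_continuous_on w {0..} (\<lambda>s. f)"
      using fe by (auto simp: ell1_continuous_on_def ell1_tendsto_def)
    with c have "ell1_continuous_on w {0..} r"
      unfolding r_def by (intro ell1_continuous_on_diff S_continuous fe)
    then show "continuous_on {0..T} (\<lambda>s. nrm (r s))"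
      using continuous_on_subset[OF continuous_on_nrm] by auto
    fix s \<epsilon> :: real assume s: "0 < s" "s \<le> T" and "0 < \<epsilon>"
    have "eventually (\<lambda>h. 0 < h \<and> h < s) (at_right 0)"
      using s(1) by (auto simp: eventually_at_right_field)
    with left_quotient_eventually[OF S_has_derivative[OF fg s(1)] \<open>0 < \<epsilon>\<close>]
    show "eventually (\<lambda>h. nrm (r s) \<le> nrm (r (s - h)) + h * (M + \<epsilon>)) (at_right 0)"
    proof eventually_elim
      case (elim h)
      let ?q = "\<lambda>n. (S s f n - S (s - h) f n) / h - S s g n"
      let ?e = "\<lambda>n. S s g n - g n"
      have q: "?q \<in> ell1 w" "?e \<in> ell1 w"
        using elim s fe by (auto intro!: ell1_diff ell1_divide S_ell1)
      have "r s = (\<lambda>n. r (s - h) n + h * (?q n + ?e n))"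
        using elim by (auto simp: fun_eq_iff r_def field_simps)
      then have "nrm (r s) \<le> nrm (r (s - h)) + nrm (\<lambda>n. h * (?q n + ?e n))"
        using nrm_add[OF r_ell1[of "s - h"] ell1_scale[OF ell1_add[OF q], of h]] elim by simp
      also have "\<dots> \<le> nrm (r (s - h)) + h * (M + \<epsilon>)"
        using nrm_scale[OF ell1_add[OF q], of h] nrm_add[OF q] elim M[OF s] by simp
      finally show ?case .
    qed
  qed
  moreover have "r 0 = (\<lambda>n. 0)" using S_0 fe by (simp add: r_def fun_eq_iff)
  ultimately show ?thesis by (simp add: r_def[abs_def])
qed

text \<open>Both sides of the remainder bound depend continuously on the pair, so the bound passes
  to the limit before \<open>(f, g)\<close> is known to belong to the generator. Dividing by
  \<open>T\<close>, with \<open>M\<close> small for small \<open>T\<close> by strong continuity at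
  \<open>g\<close>, then gives the derivative at 0.\<close>

lemma gen_closed:
  assumes FG: "\<And>k::nat. (F k, G k) \<in> gen"
    and F: "ell1_tendsto w F f sequentially" and G: "ell1_tendsto w G g sequentially"
    and fe: "f \<in> ell1 w" "g \<in> ell1 w"
  shows "(f, g) \<in> gen"
proof -
  note Fe = gen_ell1[OF FG]
  have bound: "nrm (\<lambda>n. S T f n - f n - T * g n) \<le> T * M"
    if T: "0 \<le> T" and M: "\<And>s. 0 < s \<Longrightarrow> s \<le> T \<Longrightarrow> nrm (\<lambda>n. S s g n - g n) \<le> M" for T M
  proof -
    define R where "R k n = S T (F k) n - F k n - T * G k n" for k n
    define \<delta> \<gamma> where "\<delta> k = nrm (\<lambda>n. F k n - f n)" and "\<gamma> k = nrm (\<lambda>n. G k n - g n)" for k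
    \<comment> \<open>\<open>2 * \<delta> k\<close> replaces \<open>f\<close> by \<open>F k\<close>
      in \<open>S T f\<close> and in \<open>f\<close>. Of the three \<open>T * \<gamma> k\<close>,
      two come from replacing \<open>g\<close> inside the bound \<open>M\<close> and one from the
      term \<open>T * g\<close>.\<close>
    have le: "nrm (\<lambda>n. S T f n - f n - T * g n) \<le> T * M + 2 * \<delta> k + 3 * T * \<gamma> k" for k
    proof -
      have "nrm (\<lambda>n. S s (G k) n - G k n) \<le> M + 2 * \<gamma> k" if s: "0 < s" "s \<le> T" for s
      proof -
        have e: "S s (G k) \<in> ell1 w" "S s g \<in> ell1 w" using S_ell1 s Fe fe by auto
        have "nrm (\<lambda>n. S s (G k) n - G k n)
            \<le> nrm (\<lambda>n. S s (G k) n - S s g n) + nrm (\<lambda>n. S s g n - G k n)"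
          by (rule nrm_triangle3[OF e Fe(2)])
        also have "\<dots> \<le> \<gamma> k + (nrm (\<lambda>n. S s g n - g n) + nrm (\<lambda>n. g n - G k n))"
          using S_diff_contr[of s "G k" g] s Fe fe nrm_triangle3[OF e(2) fe(2) Fe(2)]
          by (intro add_mono) (auto simp: \<gamma>_def)
        also have "\<dots> \<le> M + 2 * \<gamma> k"
          using M[OF s] nrm_minus_commute[of g "G k"] by (simp add: \<gamma>_def)
        finally show ?thesis .
      qed
      from orbit_remainder_bound[OF FG T this]
      have 1: "nrm (\<lambda>n. S T (F k) n - F k n - T * G k n) \<le> T * (M + 2 * \<gamma> k)" by blast
      let ?x = "\<lambda>n. S T (F k) n - F k n - T * G k n" and ?y = "\<lambda>n. S T (F k) n - S T f n"
        and ?z = "\<lambda>n. F k n - f n" and ?u = "\<lambda>n. G k n - g n"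
      have e: "?x \<in> ell1 w" "?y \<in> ell1 w" "?z \<in> ell1 w" "?u \<in> ell1 w"
        using Fe fe T by (auto intro!: ell1_diff ell1_scale S_ell1)
      have "nrm (\<lambda>n. S T f n - f n - T * g n) = nrm (\<lambda>n. (?x n - ?y n) + (?z n + T * ?u n))"
        by (simp add: algebra_simps)
      also have "\<dots> \<le> (nrm ?x + nrm ?y) + (nrm ?z + T * nrm ?u)"
        using nrm_add[OF ell1_diff[OF e(1,2)] ell1_add[OF e(3) ell1_scale[OF e(4), of T]]]
          nrm_diff[OF e(1,2)] nrm_add[OF e(3) ell1_scale[OF e(4), of T]] nrm_scale[OF e(4), of T] T
        by simp
      also have "nrm ?y \<le> \<delta> k" using S_diff_contr[OF T Fe(1) fe(1)] by (simp add: \<delta>_def)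
      finally show ?thesis using 1 by (simp add: \<delta>_def \<gamma>_def algebra_simps)
    qed
    have "(\<lambda>k. T * M + 2 * \<delta> k + 3 * T * \<gamma> k) \<longlonglongrightarrow> T * M + 2 * 0 + 3 * T * 0"
      using F G unfolding ell1_tendsto_def \<delta>_def \<gamma>_def by (intro tendsto_intros)
    from LIMSEQ_le_const[OF this] le show ?thesis by auto
  qed
  have "((\<lambda>h. nrm (\<lambda>n. (S h f n - f n) / h - g n)) \<longlongrightarrow> 0) (at_right 0)"
  proof (rule tendstoI)
    fix e :: real assume "0 < e"
    have "eventually (\<lambda>h. nrm (\<lambda>n. S h g n - g n) < e / 2) (at_right 0)"
      using order_tendstoD(2)[OF S_at_0[OF fe(2), unfolded ell1_tendsto_def], of "e / 2"] \<open>0 < e\<close> by simp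
    then obtain b where b: "0 < b" "\<And>s. 0 < s \<Longrightarrow> s < b \<Longrightarrow> nrm (\<lambda>n. S s g n - g n) < e / 2"
      by (auto simp: eventually_at_right_field)
    have "dist (nrm (\<lambda>n. (S h f n - f n) / h - g n)) 0 < e" if h: "0 < h" "h < b" for h
    proof -
      have "nrm (\<lambda>n. S h f n - f n - h * g n) \<le> h * (e / 2)"
        using h b(2) by (intro bound) (auto intro: less_imp_le)
      moreover have "nrm (\<lambda>n. (S h f n - f n) / h - g n) = nrm (\<lambda>n. S h f n - f n - h * g n) / h"
        using nrm_divide[of "\<lambda>n. S h f n - f n - h * g n" h] h fe
        by (simp add: ell1_diff S_ell1 ell1_scale diff_divide_distrib)
      ultimately have "nrm (\<lambda>n. (S h f n - f n) / h - g n) \<le> e / 2"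
        using h divide_right_mono[of _ "h * (e / 2)" h] by fastforce
      moreover have "0 \<le> nrm (\<lambda>n. (S h f n - f n) / h - g n)"
        using h fe by (intro nrm_nonneg ell1_diff quotient_ell1) auto
      ultimately show ?thesis using \<open>0 < e\<close> by simp
    qed
    then show "eventually (\<lambda>h. dist (nrm (\<lambda>n. (S h f n - f n) / h - g n)) 0 < e) (at_right 0)"
      using b(1) by (auto simp: eventually_at_right_field)
  qed
  then show ?thesis using fe by (simp add: semigroup_generator_def ell1_tendsto_def)
qed

end

text \<open>Contractivity is given on the cone only. The norm is additive on the positive and
  negative parts of \<open>f\<close>, so splitting costs nothing; their images may overlap, but
  there the triangle inequality suffices.\<close>

lemma (in positive_weight) substochastic_imp_contraction:
  assumes "substochastic_semigroup w S"
  shows "contraction_semigroup w S"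
proof
  show C0: "C0_semigroup w S" using assms by (simp add: substochastic_semigroup_def)
  fix t :: real and f assume t: "0 \<le> t" and f: "f \<in> ell1 w"
  define p m where "p n = max (f n) 0" and "m n = max (- f n) 0" for n
  have pm: "p \<in> ell1 w" "m \<in> ell1 w"
    using ell1_dominated[OF f ell1_zero, of p] ell1_dominated[OF f ell1_zero, of m] ell1_0[OF f]
    by (auto simp: p_def m_def)
  have nonneg: "nonneg_seq p" "nonneg_seq m" by (auto simp: nonneg_seq_def p_def m_def)
  have f_eq: "f = (\<lambda>n. p n + (-1) * m n)" by (auto simp: p_def m_def)
  have e: "S t p \<in> ell1 w" "S t m \<in> ell1 w"
    and lin: "S t f = (\<lambda>n. S t p n + (-1) * S t m n)"
    using C0 pm t ell1_scale[OF pm(2), of "-1"]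
    by (auto simp only: f_eq C0_semigroup_def bounded_linear_ell1_def)
  have "nrm (S t f) \<le> nrm (S t p) + nrm (S t m)"
    using nrm_diff[OF e] by (simp add: lin)
  also have "\<dots> \<le> nrm p + nrm m"
    using assms pm nonneg t by (intro add_mono) (auto simp: substochastic_semigroup_def)
  also have "\<dots> = (\<Sum>n. w (Suc n) * \<bar>p (Suc n)\<bar> + w (Suc n) * \<bar>m (Suc n)\<bar>)"
    unfolding ell1_norm_def using pm by (intro suminf_add ell1_summable)
  also have "\<dots> = nrm f"
    unfolding ell1_norm_def by (rule arg_cong[of _ _ suminf]) (auto simp: p_def m_def max_def algebra_simps)
  finally show "nrm (S t f) \<le> nrm f" .
qed

section \<open>The triangular kernel\<close>

text \<open>Variation of constants; non-negativity is read off the integral formula.\<close>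

lemma scalar_linear_ode:
  fixes g :: "real \<Rightarrow> real"
  assumes g: "continuous_on {0..} g"
  shows "\<exists>y. y 0 = y0 \<and>
    (\<forall>t\<ge>0. (y has_real_derivative (- \<alpha> * y t + g t)) (at t within {0..})) \<and>
    (0 \<le> y0 \<longrightarrow> (\<forall>t\<ge>0. 0 \<le> g t) \<longrightarrow> (\<forall>t\<ge>0. 0 \<le> y t))"
proof -
  define I where "I t = integral {0..t} (\<lambda>s. exp (\<alpha> * s) * g s)" for t
  define y where "y t = exp (- \<alpha> * t) * (y0 + I t)" for t
  have cont: "continuous_on {0..T} (\<lambda>s. exp (\<alpha> * s) * g s)" for T
    by (intro continuous_intros continuous_on_subset[OF g]) auto
  have "y 0 = y0" by (simp add: y_def I_def)
  moreover have "(y has_real_derivative (- \<alpha> * y t + g t)) (at t within {0..})" if "0 \<le> t" for t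
  proof -
    \<comment> \<open>The derivative of the integral is available on compact intervals; the extra
      unit keeps \<open>t\<close> away from the right end, so the one-sided filters agree.\<close>
    have "(I has_real_derivative exp (\<alpha> * t) * g t) (at t within {0..t + 1})"
      unfolding I_def using that by (intro integral_has_real_derivative cont) auto
    moreover have "at t within {0..t + 1} = at t within {0..}"
      by (rule at_within_nhd[of _ "{..<t + 1}"]) auto
    ultimately have I: "(I has_real_derivative exp (\<alpha> * t) * g t) (at t within {0..})" by simp
    have "exp (- \<alpha> * t) * (exp (\<alpha> * t) * g t) = g t"
      by (simp add: mult.assoc[symmetric] exp_minus)
    then show ?thesis
      unfolding y_def using I by (auto intro!: derivative_eq_intros simp: algebra_simps)
  qed
  moreover have "0 \<le> y t" if "0 \<le> y0" "\<forall>t\<ge>0. 0 \<le> g t" "0 \<le> t" for t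
  proof -
    have "0 \<le> I t"
      unfolding I_def using that(2)
      by (intro integral_nonneg integrable_continuous_real cont) simp
    with that(1) show ?thesis by (simp add: y_def)
  qed
  ultimately show ?thesis by (intro exI[of _ y]) simp
qed

section \<open>The triangular system and its weighted column sums\<close>

locale fragmentation = positive_weight +
  fixes a :: "nat \<Rightarrow> real" and b :: "nat \<Rightarrow> nat \<Rightarrow> real"
  assumes a_nonneg: "1 \<le> n \<Longrightarrow> 0 \<le> a n"
    and b_nonneg: "1 \<le> n \<Longrightarrow> 1 \<le> j \<Longrightarrow> 0 \<le> b n j"
    and b_zero: "1 \<le> n \<Longrightarrow> 1 \<le> j \<Longrightarrow> j \<le> n \<Longrightarrow> b n j = 0"
    and w_b: "2 \<le> j \<Longrightarrow> (\<Sum>n=1..j-1. w n * b n j) \<le> w j"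
begin

text \<open>The matrix of A + B, with the rates out of size \<open>i\<close> in column
  \<open>i\<close>. The loss term sits on the diagonal, where \<open>b\<close> vanishes.\<close>

definition q :: "nat \<Rightarrow> nat \<Rightarrow> real" where
  "q n i = (if n = i then - a i else a i * b n i)"

lemma q_lower: "1 \<le> i \<Longrightarrow> i < n \<Longrightarrow> q n i = 0"
  using b_zero by (simp add: q_def)

lemma q_upper_nonneg: "1 \<le> n \<Longrightarrow> n < i \<Longrightarrow> 0 \<le> q n i"
  using a_nonneg b_nonneg by (simp add: q_def)

lemma q_column_sum:
  assumes "1 \<le> i" "i \<le> N"
  shows "(\<Sum>n=1..N. \<omega> n * q n i) = a i * ((\<Sum>n=1..i-1. \<omega> n * b n i) - \<omega> i)"
proof -
  have "(\<Sum>n=1..N. \<omega> n * q n i) = (\<Sum>n=1..i. \<omega> n * q n i)"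
    using assms by (intro sum.mono_neutral_right) (auto simp: q_lower)
  also have "\<dots> = (\<Sum>n=1..i-1. \<omega> n * q n i) + \<omega> i * q i i"
    using assms by (cases i) auto
  also have "(\<Sum>n=1..i-1. \<omega> n * q n i) = a i * (\<Sum>n=1..i-1. \<omega> n * b n i)"
    unfolding sum_distrib_left by (rule sum.cong) (auto simp: q_def)
  finally show ?thesis by (simp add: q_def algebra_simps)
qed

text \<open>One row of the initial value problem for column \<open>j\<close>, started at the unit
  vector \<open>j\<close>. The sum begins at \<open>n\<close>, so a row refers only to itself and to
  later rows and the rows can be solved one at a time.\<close>

definition kernel_column :: "nat \<Rightarrow> (real \<Rightarrow> nat \<Rightarrow> real) \<Rightarrow> nat \<Rightarrow> bool" where
  "kernel_column j x n \<longleftrightarrow> x 0 n = (if n = j then 1 else 0) \<and> (\<forall>t\<ge>0. 0 \<le> x t n \<and>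
     ((\<lambda>t. x t n) has_real_derivative (\<Sum>i=n..j. q n i * x t i)) (at t within {0..}))"

text \<open>Back substitution from the last row: in row \<open>m\<close> the later rows are known
  and form the inhomogeneity \<open>g\<close>, which is non-negative because the off-diagonal rates
  are.\<close>

lemma kernel_column_exists: "\<exists>x. \<forall>n\<in>{1..j}. kernel_column j x n"
proof -
  \<comment> \<open>Downward induction: the range of solved rows is empty at \<open>Suc j\<close>
    and grows to \<open>{m..j}\<close>.\<close>
  have "1 \<le> Suc j \<Longrightarrow> \<exists>x. \<forall>n\<in>{1..j}. kernel_column j x n"
  proof (induction rule: inc_induct)
    case base
    then show ?case by simp
  next
    case (step m)
    then obtain x where x: "\<And>n. n \<in> {Suc m..j} \<Longrightarrow> kernel_column j x n" by blast
    define g where "g t = (\<Sum>i=Suc m..j. q m i * x t i)" for t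
    have "continuous_on {0..} (\<lambda>t. x t i)" if "i \<in> {Suc m..j}" for i
      using x[OF that] unfolding kernel_column_def
      by (intro DERIV_continuous_on) auto
    then have g: "continuous_on {0..} g"
      unfolding g_def by (intro continuous_intros) auto
    obtain y where y: "y 0 = (if m = j then 1 else 0)"
      "\<And>t. 0 \<le> t \<Longrightarrow> (y has_real_derivative (- a m * y t + g t)) (at t within {0..})"
      "(\<forall>t\<ge>0. 0 \<le> g t) \<Longrightarrow> (\<forall>t\<ge>0. 0 \<le> y t)"
      using scalar_linear_ode[OF g, of "if m = j then 1 else 0" "a m"] by (auto split: if_splits)
    have g_nonneg: "0 \<le> g t" if "0 \<le> t" for t
      unfolding g_def using x that step.hyps q_upper_nonneg
      by (intro sum_nonneg mult_nonneg_nonneg) (auto simp: kernel_column_def)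
    define x' where "x' t i = (if i = m then y t else x t i)" for t i
    have sum_eq: "(\<Sum>i=n..j. q n i * x' t i) =
        (if n = m then - a m * y t + g t else (\<Sum>i=n..j. q n i * x t i))"
      if "n \<in> {m..j}" for n t
    proof (cases "n = m")
      case True
      then have "{n..j} = insert m {Suc m..j}" using that by auto
      moreover have "(\<Sum>i=Suc m..j. q n i * x' t i) = g t"
        unfolding g_def by (rule sum.cong) (auto simp: x'_def True)
      ultimately show ?thesis by (simp add: True x'_def q_def)
    next
      case False
      have "(\<Sum>i=n..j. q n i * x' t i) = (\<Sum>i=n..j. q n i * x t i)"
        by (rule sum.cong) (use that False in \<open>auto simp: x'_def\<close>)
      with False show ?thesis by simp
    qed
    have "kernel_column j x' n" if n: "n \<in> {m..j}" for n
    proof (cases "n = m")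
      case True
      have "(\<lambda>t. x' t n) = y" by (simp add: x'_def True)
      then show ?thesis
        unfolding kernel_column_def sum_eq[OF n] using True y g_nonneg by (simp add: x'_def)
    next
      case False
      then have "(\<lambda>t. x' t n) = (\<lambda>t. x t n)" by (simp add: x'_def)
      then show ?thesis
        unfolding kernel_column_def sum_eq[OF n] using False x[of n] n
        by (simp add: x'_def kernel_column_def)
    qed
    then show ?case by blast
  qed
  then show ?thesis by simp
qed

text \<open>The entries of \<open>exp (t q)\<close>. The choice is made once per column and involves
  neither \<open>t\<close> nor \<open>n\<close>; entries off the triangle are 0, so sums may run
  over any \<open>1..N\<close> with \<open>j <= N\<close>.\<close>

definition kernel :: "real \<Rightarrow> nat \<Rightarrow> nat \<Rightarrow> real" where
  "kernel t n j = (if 1 \<le> n \<and> n \<le> j then (SOME x. \<forall>n\<in>{1..j}. kernel_column j x n) t n else 0)"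

lemma kernel_column_kernel:
  assumes "1 \<le> n" "n \<le> j"
  shows "kernel_column j (\<lambda>t n. kernel t n j) n"
proof -
  let ?x = "SOME x. \<forall>n\<in>{1..j}. kernel_column j x n"
  have x: "kernel_column j ?x n"
    using someI_ex[OF kernel_column_exists[of j]] assms by auto
  have "kernel t i j = ?x t i" if "i \<in> {n..j}" for t i
    using assms that by (simp add: kernel_def)
  then have "(\<Sum>i=n..j. q n i * kernel t i j) = (\<Sum>i=n..j. q n i * ?x t i)"
    and "kernel t n j = ?x t n" for t using assms by auto
  with x show ?thesis by (simp add: kernel_column_def)
qed

lemma kernel_outside: "j < n \<or> n = 0 \<Longrightarrow> kernel t n j = 0"
  by (auto simp: kernel_def)

lemma kernel_nonneg: "0 \<le> t \<Longrightarrow> 0 \<le> kernel t n j"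
  using kernel_column_kernel[of n j] kernel_outside[of j n t]
  by (cases "1 \<le> n \<and> n \<le> j") (auto simp: kernel_column_def)

lemma kernel_0: "1 \<le> j \<Longrightarrow> kernel 0 n j = (if n = j then 1 else 0)"
  using kernel_column_kernel[of n j] kernel_outside[of j n 0]
  by (cases "1 \<le> n \<and> n \<le> j") (auto simp: kernel_column_def)

lemma kernel_deriv:
  assumes "1 \<le> n" "1 \<le> j" "j \<le> N" "0 \<le> t"
  shows "((\<lambda>t. kernel t n j) has_real_derivative (\<Sum>i=1..N. q n i * kernel t i j)) (at t within {0..})"
proof (cases "n \<le> j")
  case True
  have "(\<Sum>i=1..N. q n i * kernel t i j) = (\<Sum>i=n..j. q n i * kernel t i j)"
    using assms True by (intro sum.mono_neutral_right) (auto simp: q_lower kernel_outside)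
  then show ?thesis using kernel_column_kernel[OF assms(1) True] assms by (simp add: kernel_column_def)
next
  case False
  have "(\<Sum>i=1..N. q n i * kernel t i j) = 0"
  proof (intro sum.neutral ballI)
    fix i assume "i \<in> {1..N}"
    then show "q n i * kernel t i j = 0"
      using False by (cases "i \<le> j") (simp_all add: kernel_outside q_lower)
  qed
  moreover have "(\<lambda>t. kernel t n j) = (\<lambda>t. 0)" using False by (simp add: kernel_outside)
  ultimately show ?thesis by simp
qed

text \<open>Exchanging the sums turns the derivative into column sums of \<open>q\<close> times
  non-negative kernel entries. No sign is asked of \<omega>, so that \<open>kernel_mass\<close> can
  use both \<open>n\<close> and \<open>- n\<close> as weight.\<close>

lemma kernel_column_sum_le:
  assumes j: "1 \<le> j" and t: "0 \<le> t"
    and dec: "\<And>i. 1 \<le> i \<Longrightarrow> i \<le> j \<Longrightarrow> (\<Sum>n=1..j. \<omega> n * q n i) \<le> 0"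
  shows "(\<Sum>n=1..j. \<omega> n * kernel t n j) \<le> \<omega> j"
proof -
  let ?f = "\<lambda>t. \<Sum>n=1..j. \<omega> n * kernel t n j"
  have deriv: "(?f has_real_derivative (\<Sum>n=1..j. \<omega> n * (\<Sum>i=1..j. q n i * kernel s i j))) (at s within {0..})"
    if "0 \<le> s" for s
    using j that by (intro DERIV_sum DERIV_cmult kernel_deriv) auto
  have "?f t \<le> ?f 0"
  proof (rule DERIV_nonpos_imp_decreasing_open[OF t])
    fix s assume s: "0 < s" "s < t"
    have "at s within {0..} = at s" using s by (intro at_within_interior) auto
    moreover have "(\<Sum>n=1..j. \<omega> n * (\<Sum>i=1..j. q n i * kernel s i j))
        = (\<Sum>i=1..j. (\<Sum>n=1..j. \<omega> n * q n i) * kernel s i j)"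
      unfolding sum_distrib_left sum_distrib_right
      by (subst sum.swap) (simp add: mult.assoc)
    moreover have "\<dots> \<le> 0"
    proof (rule sum_nonpos)
      show "(\<Sum>n=1..j. \<omega> n * q n i) * kernel s i j \<le> 0" if "i \<in> {1..j}" for i
        using that s by (intro mult_nonpos_nonneg dec kernel_nonneg) auto
    qed
    ultimately show "\<exists>y. (?f has_real_derivative y) (at s) \<and> y \<le> 0"
      using deriv[of s] s by auto
  next
    have "continuous_on {0..} ?f" using deriv by (intro DERIV_continuous_on) auto
    then show "continuous_on {0..t} ?f" by (rule continuous_on_subset) auto
  qed
  also have "?f 0 = (\<Sum>n=1..j. if n = j then \<omega> n else 0)"
    using j by (intro sum.cong) (auto simp: kernel_0)
  also have "\<dots> = \<omega> j" using j by simp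
  finally show ?thesis .
qed

text \<open>Unlike \<open>w\<close>, an admissible weight may vanish somewhere, as
  \<open>w * c\<close> does where \<open>c\<close> is 0.\<close>

definition admissible :: "(nat \<Rightarrow> real) \<Rightarrow> bool" where
  "admissible \<omega> \<longleftrightarrow> (\<forall>n\<ge>1. 0 \<le> \<omega> n) \<and> (\<forall>j\<ge>2. (\<Sum>n=1..j-1. \<omega> n * b n j) \<le> \<omega> j)"

lemma admissible_weight: "admissible w"
  using w_b w_nonneg by (simp add: admissible_def)

text \<open>Any cut-off \<open>M\<close> is allowed, for use with partial sums: a short sum drops
  non-negative terms, a long one adds zeros.\<close>

lemma kernel_column_sum_admissible:
  assumes adm: "admissible \<omega>" and j: "1 \<le> j" and t: "0 \<le> t"
  shows "(\<Sum>n=1..M. \<omega> n * kernel t n j) \<le> \<omega> j"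
proof -
  have "(\<Sum>n=1..M. \<omega> n * kernel t n j) \<le> (\<Sum>n=1..max M j. \<omega> n * kernel t n j)"
    using adm t kernel_nonneg by (intro sum_mono2) (auto simp: admissible_def)
  also have "\<dots> = (\<Sum>n=1..j. \<omega> n * kernel t n j)"
    by (intro sum.mono_neutral_right) (auto simp: kernel_outside)
  also have "\<dots> \<le> \<omega> j"
  proof (rule kernel_column_sum_le[OF j t])
    fix i assume i: "1 \<le> i" "i \<le> j"
    have "(\<Sum>n=1..i-1. \<omega> n * b n i) - \<omega> i \<le> 0"
      using adm i by (cases "i = 1") (auto simp: admissible_def)
    then show "(\<Sum>n=1..j. \<omega> n * q n i) \<le> 0"
      unfolding q_column_sum[OF i] using a_nonneg[OF i(1)] by (rule mult_nonneg_nonpos[rotated])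
  qed
  finally show ?thesis .
qed

text \<open>Once the later rows vanish, row \<open>m\<close> reads \<open>d' = - a m d\<close>, and
  the integrating factor \<open>exp (a m * t)\<close> makes it constant.\<close>

lemma triangular_ode_unique:
  assumes deriv: "\<And>n t. 1 \<le> n \<Longrightarrow> n \<le> N \<Longrightarrow> 0 \<le> t \<Longrightarrow>
      ((\<lambda>t. d t n) has_real_derivative (\<Sum>i=1..N. q n i * d t i)) (at t within {0..})"
    and init: "\<And>n. 1 \<le> n \<Longrightarrow> n \<le> N \<Longrightarrow> d 0 n = 0"
    and n: "1 \<le> n" "n \<le> N" and t: "0 \<le> t"
  shows "d t n = 0"
proof -
  have "1 \<le> Suc N \<Longrightarrow> \<forall>n\<in>{1..N}. \<forall>t\<ge>0. d t n = 0"
  proof (induction rule: inc_induct)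
    case base
    then show ?case by simp
  next
    case (step m)
    then have m: "1 \<le> m" "m \<le> N" by auto
    have "((\<lambda>t. d t m * exp (a m * t)) has_real_derivative 0) (at t within {0..})" if "0 \<le> t" for t
    proof -
      have "(\<Sum>i=1..N. q m i * d t i) = (\<Sum>i\<in>{m}. q m i * d t i)"
        using m q_lower step.IH that by (intro sum.mono_neutral_right) (auto simp: not_less_eq_eq)
      with deriv[OF m that] have "((\<lambda>t. d t m) has_real_derivative - a m * d t m) (at t within {0..})"
        by (simp add: q_def)
      then show ?thesis by (auto intro!: derivative_eq_intros simp: algebra_simps)
    qed
    then obtain c where c: "\<And>t. 0 \<le> t \<Longrightarrow> d t m * exp (a m * t) = c"
      using has_field_derivative_zero_constant[of "{0..}" "\<lambda>t. d t m * exp (a m * t)"] by auto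
    have "c = 0" using c[of 0] init[OF m] by simp
    with c have "d t m = 0" if "0 \<le> t" for t using that by fastforce
    with step.IH show ?case by (auto simp: le_eq_less_or_eq[of m] Suc_le_eq)
  qed
  with n t show ?thesis by auto
qed

text \<open>As functions of \<open>t\<close>, both sides solve the triangular system and start from
  column \<open>j\<close> of \<open>kernel s\<close>.\<close>

lemma kernel_semigroup:
  assumes s: "0 \<le> s" and t: "0 \<le> t" and j: "1 \<le> j"
  shows "kernel (t + s) n j = (\<Sum>i=1..j. kernel t n i * kernel s i j)"
proof (cases "1 \<le> n \<and> n \<le> j")
  case True
  define d where "d t n = kernel (t + s) n j - (\<Sum>i=1..j. kernel t n i * kernel s i j)" for t n
  have "d t n = 0"
  proof (rule triangular_ode_unique[of j d])
    fix n and t :: real assume n: "1 \<le> n" "n \<le> j" and t: "0 \<le> t"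
    have "((\<lambda>t. kernel t n j) has_real_derivative (\<Sum>i=1..j. q n i * kernel (t + s) i j))
        (at (t + s) within (\<lambda>t. t + s) ` {0..})"
      using kernel_deriv[OF n(1) j order_refl, of "t + s"] s t
      by (auto elim: has_field_derivative_subset)
    moreover have "((\<lambda>t. t + s) has_real_derivative 1) (at t within {0..})"
      by (auto intro!: derivative_eq_intros)
    ultimately
    have "((\<lambda>t. kernel (t + s) n j) has_real_derivative (\<Sum>i=1..j. q n i * kernel (t + s) i j)) (at t within {0..})"
      using DERIV_image_chain[of "\<lambda>t. kernel t n j" _ "\<lambda>t. t + s" t "{0..}" 1] by (simp add: o_def)
    moreover have "((\<lambda>t. \<Sum>i=1..j. kernel t n i * kernel s i j) has_real_derivative
        (\<Sum>i=1..j. (\<Sum>l=1..j. q n l * kernel t l i) * kernel s i j)) (at t within {0..})"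
      using n t by (intro DERIV_sum DERIV_cmult_right kernel_deriv) auto
    ultimately have "((\<lambda>t. d t n) has_real_derivative (\<Sum>i=1..j. q n i * kernel (t + s) i j)
        - (\<Sum>i=1..j. (\<Sum>l=1..j. q n l * kernel t l i) * kernel s i j)) (at t within {0..})"
      unfolding d_def by (rule DERIV_diff)
    moreover have "(\<Sum>i=1..j. (\<Sum>l=1..j. q n l * kernel t l i) * kernel s i j)
        = (\<Sum>l=1..j. q n l * (\<Sum>i=1..j. kernel t l i * kernel s i j))"
      unfolding sum_distrib_left sum_distrib_right by (subst sum.swap) (simp add: mult.assoc)
    ultimately show "((\<lambda>t. d t n) has_real_derivative (\<Sum>i=1..j. q n i * d t i)) (at t within {0..})"
      by (simp add: d_def sum_subtractf right_diff_distrib)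
  next
    fix n assume n: "1 \<le> n" "n \<le> j"
    have "(\<Sum>i=1..j. kernel 0 n i * kernel s i j) = (\<Sum>i=1..j. if i = n then kernel s i j else 0)"
      by (intro sum.cong) (auto simp: kernel_0)
    then show "d 0 n = 0" using n by (simp add: d_def)
  qed (use True t in auto)
  then show ?thesis by (simp add: d_def)
next
  case False
  then have "(\<Sum>i=1..j. kernel t n i * kernel s i j) = 0"
    by (intro sum.neutral) (auto simp: kernel_outside)
  with False show ?thesis by (auto simp: kernel_def)
qed

end

section \<open>The kernel semigroup and its generator\<close>

text \<open>Independent of the particular kernel, since it also represents B by way of
  \<open>bker\<close>.\<close>

definition kernel_op :: "(nat \<Rightarrow> nat \<Rightarrow> real) \<Rightarrow> (nat \<Rightarrow> real) \<Rightarrow> nat \<Rightarrow> real" where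
  "kernel_op K f n = (if n = 0 then 0 else (\<Sum>k. K n (Suc k) * f (Suc k)))"

text \<open>A single entry is at most its column sum, so
  \<open>K n j <= \<nu> j / \<omega> n\<close>. The division asks for a strictly positive weight;
  \<open>kernel_op_bound\<close> takes row summability as a premise so that its own \<omega> may
  vanish.\<close>

lemma kernel_row_summable:
  fixes K :: "nat \<Rightarrow> nat \<Rightarrow> real" and f \<omega> \<nu> :: "nat \<Rightarrow> real"
  assumes K: "\<And>n j. 1 \<le> n \<Longrightarrow> 1 \<le> j \<Longrightarrow> 0 \<le> K n j"
    and \<omega>: "\<And>n. 1 \<le> n \<Longrightarrow> 0 < \<omega> n"
    and col: "\<And>j M. 1 \<le> j \<Longrightarrow> (\<Sum>n=1..M. \<omega> n * K n j) \<le> \<nu> j"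
    and f: "summable (\<lambda>k. \<nu> (Suc k) * \<bar>f (Suc k)\<bar>)"
    and n: "1 \<le> n"
  shows "summable (\<lambda>k. K n (Suc k) * \<bar>f (Suc k)\<bar>)"
proof (rule summable_comparison_test'[where N = 0])
  show "summable (\<lambda>k. (1 / \<omega> n) * (\<nu> (Suc k) * \<bar>f (Suc k)\<bar>))"
    by (rule summable_mult[OF f])
  fix k
  have "\<omega> n * K n (Suc k) \<le> (\<Sum>i=1..n. \<omega> i * K i (Suc k))"
    using n K \<omega> by (intro member_le_sum[of n "{1..n}" "\<lambda>i. \<omega> i * K i (Suc k)"])
      (auto simp: less_imp_le)
  also have "\<dots> \<le> \<nu> (Suc k)" by (intro col) simp
  finally have "K n (Suc k) \<le> (1 / \<omega> n) * \<nu> (Suc k)"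
    using \<omega>[OF n] by (simp add: field_simps)
  from mult_right_mono[OF this, of "\<bar>f (Suc k)\<bar>"]
  show "norm (K n (Suc k) * \<bar>f (Suc k)\<bar>) \<le> (1 / \<omega> n) * (\<nu> (Suc k) * \<bar>f (Suc k)\<bar>)"
    using K[OF n, of "Suc k"] by (simp add: abs_mult mult.assoc)
qed

text \<open>For finitely many rows the sum over rows commutes with the series over columns, and the
  column bound is uniform in the number of rows. Source and target weights are separate because B
  maps the space with weight \<open>w * a\<close> into that with weight \<open>w\<close>.\<close>

lemma kernel_op_bound:
  fixes K :: "nat \<Rightarrow> nat \<Rightarrow> real" and f \<omega> \<nu> :: "nat \<Rightarrow> real"
  assumes K: "\<And>n j. 1 \<le> n \<Longrightarrow> 1 \<le> j \<Longrightarrow> 0 \<le> K n j"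
    and \<omega>: "\<And>n. 1 \<le> n \<Longrightarrow> 0 \<le> \<omega> n"
    and col: "\<And>j M. 1 \<le> j \<Longrightarrow> (\<Sum>n=1..M. \<omega> n * K n j) \<le> \<nu> j"
    and f: "summable (\<lambda>k. \<nu> (Suc k) * \<bar>f (Suc k)\<bar>)"
    and row: "\<And>n. 1 \<le> n \<Longrightarrow> summable (\<lambda>k. K n (Suc k) * \<bar>f (Suc k)\<bar>)"
  shows "summable (\<lambda>n. \<omega> (Suc n) * \<bar>kernel_op K f (Suc n)\<bar>)"
    and "(\<Sum>n. \<omega> (Suc n) * \<bar>kernel_op K f (Suc n)\<bar>) \<le> (\<Sum>k. \<nu> (Suc k) * \<bar>f (Suc k)\<bar>)"
proof -
  let ?g = "\<lambda>n. \<omega> (Suc n) * \<bar>kernel_op K f (Suc n)\<bar>"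
  have partial: "(\<Sum>n<M. ?g n) \<le> (\<Sum>k. \<nu> (Suc k) * \<bar>f (Suc k)\<bar>)" for M
  proof -
    have row': "summable (\<lambda>k. \<omega> (Suc n) * (K (Suc n) (Suc k) * \<bar>f (Suc k)\<bar>))" for n
      by (intro summable_mult row) simp
    have "(\<Sum>n<M. ?g n) \<le> (\<Sum>n<M. \<Sum>k. \<omega> (Suc n) * (K (Suc n) (Suc k) * \<bar>f (Suc k)\<bar>))"
    proof (rule sum_mono)
      fix n
      have "\<bar>\<Sum>k. K (Suc n) (Suc k) * f (Suc k)\<bar> \<le> (\<Sum>k. \<bar>K (Suc n) (Suc k) * f (Suc k)\<bar>)"
        using row[of "Suc n"] K by (intro summable_rabs) (simp add: abs_mult)
      also have "\<dots> = (\<Sum>k. K (Suc n) (Suc k) * \<bar>f (Suc k)\<bar>)" using K by (simp add: abs_mult)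
      finally have "?g n \<le> \<omega> (Suc n) * (\<Sum>k. K (Suc n) (Suc k) * \<bar>f (Suc k)\<bar>)"
        using \<omega> by (simp add: kernel_op_def mult_left_mono)
      then show "?g n \<le> (\<Sum>k. \<omega> (Suc n) * (K (Suc n) (Suc k) * \<bar>f (Suc k)\<bar>))"
        using suminf_mult[OF row[of "Suc n"]] by simp
    qed
    also have "\<dots> = (\<Sum>k. \<Sum>n<M. \<omega> (Suc n) * (K (Suc n) (Suc k) * \<bar>f (Suc k)\<bar>))"
      by (rule suminf_sum[symmetric]) (rule row')
    also have "\<dots> \<le> (\<Sum>k. \<nu> (Suc k) * \<bar>f (Suc k)\<bar>)"
    proof (rule suminf_le[OF _ summable_sum[OF row'] f])
      fix k
      have "(\<Sum>n<M. \<omega> (Suc n) * (K (Suc n) (Suc k) * \<bar>f (Suc k)\<bar>))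
          = (\<Sum>n=1..M. \<omega> n * K n (Suc k)) * \<bar>f (Suc k)\<bar>"
        unfolding sum_distrib_right
        by (rule sum.reindex_bij_witness[of _ "\<lambda>n. n - 1" Suc]) auto
      then show "(\<Sum>n<M. \<omega> (Suc n) * (K (Suc n) (Suc k) * \<bar>f (Suc k)\<bar>)) \<le> \<nu> (Suc k) * \<bar>f (Suc k)\<bar>"
        using mult_right_mono[OF col[of "Suc k" M], of "\<bar>f (Suc k)\<bar>"] by simp
    qed
    finally show ?thesis .
  qed
  have nonneg: "0 \<le> ?g n" for n using \<omega> by simp
  show s: "summable ?g" by (rule summableI_nonneg_bounded[OF nonneg partial])
  show "suminf ?g \<le> (\<Sum>k. \<nu> (Suc k) * \<bar>f (Suc k)\<bar>)" by (rule suminf_le_const[OF s partial])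
qed

section \<open>Finitely supported sequences and truncation\<close>

definition fin_seq :: "nat \<Rightarrow> (nat \<Rightarrow> real) \<Rightarrow> bool" where
  "fin_seq N f \<longleftrightarrow> f 0 = 0 \<and> (\<forall>n>N. f n = 0)"

definition trunc :: "nat \<Rightarrow> (nat \<Rightarrow> real) \<Rightarrow> nat \<Rightarrow> real" where
  "trunc N f n = (if n \<le> N then f n else 0)"

lemma suminf_fin_seq:
  fixes g :: "nat \<Rightarrow> real"
  assumes "\<And>k. N \<le> k \<Longrightarrow> g (Suc k) = 0"
  shows "(\<Sum>k. g (Suc k)) = (\<Sum>n=1..N. g n)" and "summable (\<lambda>k. g (Suc k))"
proof -
  have 0: "k \<notin> {..<N} \<Longrightarrow> g (Suc k) = 0" for k using assms by simp
  have "(\<Sum>k. g (Suc k)) = (\<Sum>k<N. g (Suc k))" by (rule suminf_finite) (use 0 in auto)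
  also have "\<dots> = (\<Sum>n=1..N. g n)"
    by (rule sum.reindex_bij_witness[of _ "\<lambda>n. n - 1" Suc]) auto
  finally show "(\<Sum>k. g (Suc k)) = (\<Sum>n=1..N. g n)" .
  show "summable (\<lambda>k. g (Suc k))" by (rule summable_finite[of "{..<N}"]) (use 0 in auto)
qed

lemma kernel_op_fin_seq:
  "fin_seq N f \<Longrightarrow> 1 \<le> n \<Longrightarrow> kernel_op K f n = (\<Sum>j=1..N. K n j * f j)"
  using suminf_fin_seq(1)[of N "\<lambda>j. K n j * f j"] by (simp add: kernel_op_def fin_seq_def)

lemma (in positive_weight) fin_seq_ell1:
  assumes "fin_seq N f"
  shows "f \<in> ell1 w" and "nrm f = (\<Sum>n=1..N. w n * \<bar>f n\<bar>)"
  using suminf_fin_seq[of N "\<lambda>n. w n * \<bar>f n\<bar>"] assms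
  by (auto simp: ell1_def ell1_norm_def fin_seq_def)

lemma (in positive_weight) fin_seq_tendsto:
  assumes X: "eventually (\<lambda>x. fin_seq N (X x)) F" and f: "fin_seq N f"
    and lim: "\<And>n. 1 \<le> n \<Longrightarrow> n \<le> N \<Longrightarrow> ((\<lambda>x. X x n) \<longlongrightarrow> f n) F"
  shows "ell1_tendsto w X f F"
proof -
  have "((\<lambda>x. \<Sum>n=1..N. w n * \<bar>X x n - f n\<bar>) \<longlongrightarrow> (\<Sum>n=1..N. w n * \<bar>f n - f n\<bar>)) F"
    using lim by (intro tendsto_sum tendsto_mult tendsto_rabs tendsto_diff tendsto_const) auto
  moreover have "eventually (\<lambda>x. (\<Sum>n=1..N. w n * \<bar>X x n - f n\<bar>) = nrm (\<lambda>n. X x n - f n)) F"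
    using X
  proof eventually_elim
    case (elim x)
    then have "fin_seq N (\<lambda>n. X x n - f n)" using f by (simp add: fin_seq_def)
    then show ?case by (simp add: fin_seq_ell1)
  qed
  ultimately show ?thesis
    unfolding ell1_tendsto_def by (simp add: Lim_transform_eventually)
qed

lemma fin_seq_trunc: "f 0 = 0 \<Longrightarrow> fin_seq N (trunc N f)"
  by (simp add: fin_seq_def trunc_def)

lemma (in positive_weight) trunc_tendsto:
  assumes f: "f \<in> ell1 w"
  shows "ell1_tendsto w (\<lambda>N. trunc N f) f sequentially"
proof -
  define h where "h n = w (Suc n) * \<bar>f (Suc n)\<bar>" for n
  have h: "summable h" using ell1_summable[OF f] by (simp add: h_def[abs_def])
  have eq: "nrm (\<lambda>n. trunc N f n - f n) = suminf h - sum h {..<N}" for N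
  proof -
    let ?g = "\<lambda>n. if n \<in> {..<N} then h n else 0"
    have "(\<lambda>n. h n - ?g n) sums (suminf h - sum h {..<N})"
      by (intro sums_diff summable_sums[OF h] sums_If_finite_set) auto
    moreover have "(\<lambda>n. h n - ?g n) = (\<lambda>n. w (Suc n) * \<bar>trunc N f (Suc n) - f (Suc n)\<bar>)"
      by (auto simp: h_def trunc_def)
    ultimately show ?thesis by (simp add: ell1_norm_def sums_iff)
  qed
  have "(\<lambda>N. suminf h - sum h {..<N}) \<longlonglongrightarrow> suminf h - suminf h"
    by (intro tendsto_diff tendsto_const summable_LIMSEQ h)
  then show ?thesis by (simp add: ell1_tendsto_def eq)
qed

text \<open>A density argument in quantitative form: \<open>K\<close> collects the Lipschitz
  constants of the two sides of an identity known for truncations.\<close>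

lemma (in positive_weight) ell1_eqI_of_trunc:
  assumes f: "f \<in> ell1 w" and gh: "g \<in> ell1 w" "h \<in> ell1 w"
    and le: "\<And>N. nrm (\<lambda>n. g n - h n) \<le> K * nrm (\<lambda>n. trunc N f n - f n)"
  shows "g = h"
proof (rule nrm_diff_le_0_imp_eq[OF gh])
  have "(\<lambda>N. K * nrm (\<lambda>n. trunc N f n - f n)) \<longlonglongrightarrow> K * 0"
    using trunc_tendsto[OF f] unfolding ell1_tendsto_def by (intro tendsto_intros)
  from LIMSEQ_le_const[OF this] le show "nrm (\<lambda>n. g n - h n) \<le> 0" by auto
qed

section \<open>The kernel semigroup on \<open>ell1 w\<close>\<close>

context fragmentation begin

definition kernel_flow :: "real \<Rightarrow> (nat \<Rightarrow> real) \<Rightarrow> nat \<Rightarrow> real" where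
  "kernel_flow t = kernel_op (kernel t)"

lemma kernel_summable:
  assumes f: "f \<in> ell1 w" and t: "0 \<le> t" and n: "1 \<le> n"
  shows "summable (\<lambda>k. kernel t n (Suc k) * \<bar>f (Suc k)\<bar>)" "summable (\<lambda>k. kernel t n (Suc k) * f (Suc k))"
proof -
  show s: "summable (\<lambda>k. kernel t n (Suc k) * \<bar>f (Suc k)\<bar>)"
    by (rule kernel_row_summable[of "kernel t" w w f n, OF kernel_nonneg[OF t] w_pos
          kernel_column_sum_admissible[OF admissible_weight _ t] ell1_summable[OF f] n])
  show "summable (\<lambda>k. kernel t n (Suc k) * f (Suc k))"
    by (rule summable_rabs_cancel) (use s kernel_nonneg[OF t] in \<open>simp add: abs_mult\<close>)
qed

text \<open>Convergence of the rows comes from \<open>w\<close>, and \<omega> only measures the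
  result. For \<open>\<omega> = w * c\<close> this yields the invariance of the domain of C.\<close>

lemma kernel_flow_admissible:
  assumes f: "f \<in> ell1 w" and t: "0 \<le> t" and adm: "admissible \<omega>"
    and s: "summable (\<lambda>k. \<omega> (Suc k) * \<bar>f (Suc k)\<bar>)"
  shows "summable (\<lambda>n. \<omega> (Suc n) * \<bar>kernel_flow t f (Suc n)\<bar>)"
    and "(\<Sum>n. \<omega> (Suc n) * \<bar>kernel_flow t f (Suc n)\<bar>) \<le> (\<Sum>k. \<omega> (Suc k) * \<bar>f (Suc k)\<bar>)"
  unfolding kernel_flow_def
proof -
  have \<omega>: "1 \<le> n \<Longrightarrow> 0 \<le> \<omega> n" for n using adm by (simp add: admissible_def)
  note * = kernel_op_bound[of "kernel t" \<omega> \<omega> f, OF kernel_nonneg[OF t] \<omega>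
      kernel_column_sum_admissible[OF adm _ t] s kernel_summable(1)[OF f t]]
  show "summable (\<lambda>n. \<omega> (Suc n) * \<bar>kernel_op (kernel t) f (Suc n)\<bar>)" by (rule *(1))
  show "(\<Sum>n. \<omega> (Suc n) * \<bar>kernel_op (kernel t) f (Suc n)\<bar>) \<le> (\<Sum>k. \<omega> (Suc k) * \<bar>f (Suc k)\<bar>)"
    by (rule *(2))
qed

lemma kernel_flow_ell1: "f \<in> ell1 w \<Longrightarrow> 0 \<le> t \<Longrightarrow> kernel_flow t f \<in> ell1 w"
  and kernel_flow_contr: "f \<in> ell1 w \<Longrightarrow> 0 \<le> t \<Longrightarrow> nrm (kernel_flow t f) \<le> nrm f"
proof -
  assume f: "f \<in> ell1 w" and t: "0 \<le> t"
  note * = kernel_flow_admissible[OF f t admissible_weight ell1_summable[OF f]]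
  show "kernel_flow t f \<in> ell1 w" using *(1) by (simp add: ell1_def kernel_flow_def kernel_op_def)
  show "nrm (kernel_flow t f) \<le> nrm f" using *(2) by (simp add: ell1_norm_def)
qed

lemma kernel_flow_add:
  "f \<in> ell1 w \<Longrightarrow> g \<in> ell1 w \<Longrightarrow> 0 \<le> t \<Longrightarrow> kernel_flow t (\<lambda>n. f n + g n) = (\<lambda>n. kernel_flow t f n + kernel_flow t g n)"
  by (auto simp: kernel_flow_def kernel_op_def fun_eq_iff distrib_left suminf_add[symmetric] kernel_summable)

lemma kernel_flow_scale:
  "f \<in> ell1 w \<Longrightarrow> 0 \<le> t \<Longrightarrow> kernel_flow t (\<lambda>n. r * f n) = (\<lambda>n. r * kernel_flow t f n)"
  by (auto simp: kernel_flow_def kernel_op_def fun_eq_iff mult.left_commute[of _ r] suminf_mult kernel_summable)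

lemma kernel_flow_diff:
  assumes "f \<in> ell1 w" "g \<in> ell1 w" "0 \<le> t"
  shows "kernel_flow t (\<lambda>n. f n - g n) = (\<lambda>n. kernel_flow t f n - kernel_flow t g n)"
  using kernel_flow_add[OF assms(1) ell1_scale[OF assms(2), of "-1"] assms(3)] kernel_flow_scale[OF assms(2,3), of "-1"]
  by simp

lemma kernel_flow_diff_contr:
  assumes "f \<in> ell1 w" "g \<in> ell1 w" "0 \<le> t"
  shows "nrm (\<lambda>n. kernel_flow t f n - kernel_flow t g n) \<le> nrm (\<lambda>n. f n - g n)"
  using kernel_flow_contr[OF ell1_diff[OF assms(1,2)] assms(3)] kernel_flow_diff[OF assms] by simp

lemma kernel_flow_fin_seq:
  assumes "fin_seq N f"
  shows "1 \<le> n \<Longrightarrow> kernel_flow t f n = (\<Sum>j=1..N. kernel t n j * f j)" and "fin_seq N (kernel_flow t f)"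
proof -
  show *: "kernel_flow t f n = (\<Sum>j=1..N. kernel t n j * f j)" if "1 \<le> n" for n
    unfolding kernel_flow_def by (rule kernel_op_fin_seq[OF assms that])
  show "fin_seq N (kernel_flow t f)"
    unfolding fin_seq_def
  proof (intro conjI allI impI)
    show "kernel_flow t f 0 = 0" by (simp add: kernel_flow_def kernel_op_def)
    show "kernel_flow t f n = 0" if "N < n" for n
      using that by (simp add: * kernel_outside)
  qed
qed

lemma kernel_flow_0: "f \<in> ell1 w \<Longrightarrow> kernel_flow 0 f = f"
proof
  fix n assume f: "f \<in> ell1 w"
  show "kernel_flow 0 f n = f n"
  proof (cases "n = 0")
    case True
    then show ?thesis using ell1_0[OF f] by (simp add: kernel_flow_def kernel_op_def)
  next
    case False
    have "(\<Sum>k. kernel 0 n (Suc k) * f (Suc k)) = (\<Sum>k\<in>{n - 1}. kernel 0 n (Suc k) * f (Suc k))"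
      using False by (intro suminf_finite) (auto simp: kernel_0)
    then show ?thesis using False by (simp add: kernel_flow_def kernel_op_def kernel_0)
  qed
qed

lemma kernel_flow_plus_fin_seq:
  assumes f: "fin_seq N f" and "0 \<le> s" "0 \<le> t"
  shows "kernel_flow (s + t) f = kernel_flow s (kernel_flow t f)"
proof
  fix n
  show "kernel_flow (s + t) f n = kernel_flow s (kernel_flow t f) n"
  proof (cases "n = 0")
    case True
    then show ?thesis by (simp add: kernel_flow_def kernel_op_def)
  next
    case False
    then have n: "1 \<le> n" by simp
    have "kernel_flow (s + t) f n = (\<Sum>j=1..N. (\<Sum>i=1..N. kernel s n i * kernel t i j) * f j)"
      unfolding kernel_flow_fin_seq(1)[OF f n]
    proof (rule sum.cong[OF refl])
      fix j assume j: "j \<in> {1..N}"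
      have "(\<Sum>i=1..j. kernel s n i * kernel t i j) = (\<Sum>i=1..N. kernel s n i * kernel t i j)"
        using j by (intro sum.mono_neutral_left) (auto simp: kernel_outside)
      then show "kernel (s + t) n j * f j = (\<Sum>i=1..N. kernel s n i * kernel t i j) * f j"
        using kernel_semigroup[of t s j n] assms j by simp
    qed
    also have "\<dots> = (\<Sum>i=1..N. kernel s n i * (\<Sum>j=1..N. kernel t i j * f j))"
      unfolding sum_distrib_left sum_distrib_right by (subst sum.swap) (simp add: mult.assoc)
    also have "\<dots> = kernel_flow s (kernel_flow t f) n"
      using kernel_flow_fin_seq(1)[OF f] kernel_flow_fin_seq(1)[OF kernel_flow_fin_seq(2)[OF f] n] by simp
    finally show ?thesis .
  qed
qed

lemma kernel_flow_plus:
  assumes f: "f \<in> ell1 w" and s: "0 \<le> s" and t: "0 \<le> t"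
  shows "kernel_flow (s + t) f = kernel_flow s (kernel_flow t f)"
\<comment> \<open>The 2 counts one truncation error for each side of the identity.\<close>
proof (rule ell1_eqI_of_trunc[OF f, of _ _ 2])
  fix N
  let ?f = "trunc N f"
  have fN: "fin_seq N ?f" by (rule fin_seq_trunc[of f, OF ell1_0[OF f]])
  note e = fin_seq_ell1(1)[OF fN]
  have "nrm (\<lambda>n. kernel_flow (s + t) f n - kernel_flow s (kernel_flow t f) n)
      \<le> nrm (\<lambda>n. kernel_flow (s + t) f n - kernel_flow (s + t) ?f n) + nrm (\<lambda>n. kernel_flow s (kernel_flow t ?f) n - kernel_flow s (kernel_flow t f) n)"
    using nrm_triangle3[of "kernel_flow (s + t) f" "kernel_flow (s + t) ?f" "kernel_flow s (kernel_flow t f)"] e f s t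
    by (simp add: kernel_flow_plus_fin_seq[OF fN s t] kernel_flow_ell1)
  moreover have "nrm (\<lambda>n. kernel_flow (s + t) f n - kernel_flow (s + t) ?f n) \<le> nrm (\<lambda>n. f n - ?f n)"
    using kernel_flow_diff_contr[OF f e, of "s + t"] s t by simp
  moreover have "nrm (\<lambda>n. kernel_flow s (kernel_flow t ?f) n - kernel_flow s (kernel_flow t f) n) \<le> nrm (\<lambda>n. kernel_flow t ?f n - kernel_flow t f n)"
    using kernel_flow_diff_contr[OF kernel_flow_ell1[OF e t] kernel_flow_ell1[OF f t] s] .
  moreover have "nrm (\<lambda>n. kernel_flow t ?f n - kernel_flow t f n) \<le> nrm (\<lambda>n. ?f n - f n)"
    using kernel_flow_diff_contr[OF e f t] .
  ultimately show "nrm (\<lambda>n. kernel_flow (s + t) f n - kernel_flow s (kernel_flow t f) n) \<le> 2 * nrm (\<lambda>n. ?f n - f n)"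
    by (simp add: nrm_minus_commute[of f])
qed (use f s t kernel_flow_ell1 in auto)

lemma kernel_tendsto_0: "1 \<le> n \<Longrightarrow> 1 \<le> j \<Longrightarrow> ((\<lambda>h. kernel h n j) \<longlongrightarrow> kernel 0 n j) (at_right 0)"
  and kernel_quotient: "1 \<le> n \<Longrightarrow> 1 \<le> j \<Longrightarrow> ((\<lambda>h. (kernel h n j - kernel 0 n j) / h) \<longlongrightarrow> q n j) (at_right 0)"
proof -
  assume n: "1 \<le> n" and j: "1 \<le> j"
  have "(\<Sum>i=1..j. q n i * kernel 0 i j) = (\<Sum>i=1..j. if i = j then q n i else 0)"
    using j by (intro sum.cong) (auto simp: kernel_0)
  then have "((\<lambda>t. kernel t n j) has_real_derivative q n j) (at 0 within {0..})"
    using kernel_deriv[OF n j order_refl, of 0] j by simp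
  then have d: "((\<lambda>t. kernel t n j) has_real_derivative q n j) (at_right 0)"
    by (rule has_field_derivative_subset) auto
  from has_field_derivative_imp_has_derivative[OF this, THEN has_derivative_continuous]
  show "((\<lambda>h. kernel h n j) \<longlongrightarrow> kernel 0 n j) (at_right 0)"
    by (simp add: continuous_within)
  from d show "((\<lambda>h. (kernel h n j - kernel 0 n j) / h) \<longlongrightarrow> q n j) (at_right 0)"
    by (simp add: has_field_derivative_iff)
qed

lemma kernel_flow_tendsto_fin_seq:
  assumes f: "fin_seq N f"
  shows "ell1_tendsto w (\<lambda>t. kernel_flow t f) f (at_right 0)"
proof (rule fin_seq_tendsto)
  fix n assume n: "1 \<le> n" "n \<le> N"
  have "((\<lambda>t. \<Sum>j=1..N. kernel t n j * f j) \<longlongrightarrow> (\<Sum>j=1..N. kernel 0 n j * f j)) (at_right 0)"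
    using n by (intro tendsto_sum tendsto_mult kernel_tendsto_0 tendsto_const) auto
  moreover have "(\<Sum>j=1..N. kernel 0 n j * f j) = f n"
    using kernel_flow_0[OF fin_seq_ell1(1)[OF f]] kernel_flow_fin_seq(1)[OF f n(1), of 0] by simp
  ultimately show "((\<lambda>t. kernel_flow t f n) \<longlongrightarrow> f n) (at_right 0)"
    by (simp add: kernel_flow_fin_seq(1)[OF f n(1)])
qed (use kernel_flow_fin_seq f in auto)

lemma kernel_flow_tendsto:
  assumes f: "f \<in> ell1 w"
  shows "ell1_tendsto w (\<lambda>t. kernel_flow t f) f (at_right 0)"
  unfolding ell1_tendsto_def
proof (rule tendstoI)
  fix e :: real assume e: "0 < e"
  have "eventually (\<lambda>N. nrm (\<lambda>n. trunc N f n - f n) < e / 3) sequentially"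
    using order_tendstoD(2)[OF trunc_tendsto[OF f, unfolded ell1_tendsto_def], of "e / 3"] e by simp
  then obtain N where N: "nrm (\<lambda>n. trunc N f n - f n) < e / 3"
    by (auto simp: eventually_sequentially)
  let ?f = "trunc N f"
  have fN: "fin_seq N ?f" by (rule fin_seq_trunc[of f, OF ell1_0[OF f]])
  note fe = fin_seq_ell1(1)[OF fN]
  have "eventually (\<lambda>t. nrm (\<lambda>n. kernel_flow t ?f n - ?f n) < e / 3) (at_right 0)"
    using order_tendstoD(2)[OF kernel_flow_tendsto_fin_seq[OF fN, unfolded ell1_tendsto_def], of "e / 3"] e by simp
  then show "eventually (\<lambda>t. dist (nrm (\<lambda>n. kernel_flow t f n - f n)) 0 < e) (at_right 0)"
    using eventually_at_right_less[of "0::real"]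
  proof eventually_elim
    case (elim t)
    then have t: "0 \<le> t" by simp
    have "nrm (\<lambda>n. kernel_flow t f n - f n)
        \<le> nrm (\<lambda>n. kernel_flow t f n - kernel_flow t ?f n) + (nrm (\<lambda>n. kernel_flow t ?f n - ?f n) + nrm (\<lambda>n. ?f n - f n))"
      using nrm_triangle3[of "kernel_flow t f" "kernel_flow t ?f" f] nrm_triangle3[of "kernel_flow t ?f" ?f f] f fe t
      by (simp add: kernel_flow_ell1)
    also have "nrm (\<lambda>n. kernel_flow t f n - kernel_flow t ?f n) \<le> nrm (\<lambda>n. ?f n - f n)"
      using kernel_flow_diff_contr[OF f fe t] by (simp add: nrm_minus_commute[of f])
    finally show ?case
      using N elim nrm_nonneg[OF ell1_diff[OF kernel_flow_ell1[OF f t] f]] by simp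
  qed
qed

lemma kernel_flow_substochastic: "substochastic_semigroup w kernel_flow"
  unfolding substochastic_semigroup_def C0_semigroup_def bounded_linear_ell1_def
proof (intro conjI allI ballI impI)
  show "\<exists>K. \<forall>f\<in>ell1 w. nrm (kernel_flow t f) \<le> K * nrm f" if "0 \<le> t" for t
    using kernel_flow_contr that by (intro exI[of _ 1]) auto
  show "nonneg_seq (kernel_flow t f)" if "0 \<le> t" "f \<in> ell1 w" "nonneg_seq f" for t f
    unfolding nonneg_seq_def
  proof (intro allI impI)
    fix n :: nat assume n: "1 \<le> n"
    have "0 \<le> (\<Sum>k. kernel t n (Suc k) * f (Suc k))"
      using that n by (intro suminf_nonneg kernel_summable mult_nonneg_nonneg kernel_nonneg)
        (auto simp: nonneg_seq_def)
    then show "0 \<le> kernel_flow t f n" using n by (simp add: kernel_flow_def kernel_op_def)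
  qed
qed (auto simp: kernel_flow_ell1 kernel_flow_add kernel_flow_scale kernel_flow_0 kernel_flow_plus kernel_flow_tendsto kernel_flow_contr)

sublocale kernel_flow: contraction_semigroup w kernel_flow
  by (rule substochastic_imp_contraction[OF kernel_flow_substochastic])

section \<open>The operator A + B on the domain of A\<close>

definition domA :: "(nat \<Rightarrow> real) set" where
  "domA = {f. f \<in> ell1 w \<and> (\<lambda>n. a n * f n) \<in> ell1 w}"

definition AB :: "(nat \<Rightarrow> real) \<Rightarrow> nat \<Rightarrow> real" where
  "AB f n = - a n * f n + B_seq a b f n"

definition bker :: "nat \<Rightarrow> nat \<Rightarrow> real" where "bker n j = a j * b n j"

lemma bker_nonneg: "1 \<le> n \<Longrightarrow> 1 \<le> j \<Longrightarrow> 0 \<le> bker n j"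
  using a_nonneg b_nonneg by (simp add: bker_def)

text \<open>Column by column, B is bounded relative to A with constant 1; \<open>B_nrm\<close> draws
  the conclusion for norms.\<close>

lemma bker_column:
  assumes "1 \<le> j" shows "(\<Sum>n=1..M. w n * bker n j) \<le> w j * a j"
proof -
  have "(\<Sum>n=1..M. w n * bker n j) \<le> (\<Sum>n=1..max M j. w n * bker n j)"
    using bker_nonneg assms w_nonneg by (intro sum_mono2) auto
  also have "\<dots> = (\<Sum>n=1..j-1. w n * bker n j)"
    using assms by (intro sum.mono_neutral_right) (auto simp: bker_def b_zero)
  also have "\<dots> = a j * (\<Sum>n=1..j-1. w n * b n j)"
    unfolding sum_distrib_left by (simp add: bker_def algebra_simps)
  also have "\<dots> \<le> a j * w j"
    using a_nonneg[OF assms] w_b[of j] w_nonneg[OF assms] assms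
    by (cases "j = 1") (auto intro!: mult_left_mono)
  finally show ?thesis by (simp add: mult.commute)
qed

lemma domA_summable: "f \<in> domA \<Longrightarrow> summable (\<lambda>k. w (Suc k) * a (Suc k) * \<bar>f (Suc k)\<bar>)"
  using ell1_summable[of "\<lambda>n. a n * f n"] a_nonneg by (simp add: domA_def abs_mult mult.assoc)

lemma bker_summable:
  assumes "f \<in> domA" "1 \<le> n"
  shows "summable (\<lambda>k. bker n (Suc k) * \<bar>f (Suc k)\<bar>)" "summable (\<lambda>k. bker n (Suc k) * f (Suc k))"
proof -
  show s: "summable (\<lambda>k. bker n (Suc k) * \<bar>f (Suc k)\<bar>)"
    by (rule kernel_row_summable[of bker w "\<lambda>j. w j * a j"])
      (use bker_nonneg w_pos bker_column domA_summable assms in auto)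
  show "summable (\<lambda>k. bker n (Suc k) * f (Suc k))"
    by (rule summable_rabs_cancel) (use s bker_nonneg assms(2) in \<open>simp add: abs_mult\<close>)
qed

text \<open>One series starts at index \<open>n + 1\<close>, the other at 1; the terms with indices
  1 to \<open>n\<close> vanish together with \<open>b\<close>.\<close>

lemma B_seq_eq_kernel_op:
  assumes "f \<in> domA"
  shows "B_seq a b f = kernel_op bker f"
proof
  fix n
  show "B_seq a b f n = kernel_op bker f n"
  proof (cases "n = 0")
    case False
    then have n: "1 \<le> n" by simp
    have "(\<Sum>i<n. bker n (Suc i) * f (Suc i)) = 0"
      using n by (intro sum.neutral) (auto simp: bker_def b_zero)
    with suminf_split_initial_segment[OF bker_summable(2)[OF assms n], of n]
    show ?thesis using n by (simp add: B_seq_def kernel_op_def bker_def algebra_simps)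
  qed (simp add: B_seq_def kernel_op_def)
qed

lemma B_summable:
  assumes "f \<in> domA" "1 \<le> n"
  shows "summable (\<lambda>k. a (n + 1 + k) * b n (n + 1 + k) * f (n + 1 + k))"
  using summable_ignore_initial_segment[OF bker_summable(2)[OF assms], of n]
  by (simp add: bker_def algebra_simps)

lemma B_ell1: "f \<in> domA \<Longrightarrow> B_seq a b f \<in> ell1 w"
  and B_nrm: "f \<in> domA \<Longrightarrow> nrm (B_seq a b f) \<le> nrm (\<lambda>n. a n * f n)"
proof -
  assume f: "f \<in> domA"
  note * = kernel_op_bound[of bker w "\<lambda>j. w j * a j" f, OF bker_nonneg w_nonneg bker_column
      domA_summable[OF f] bker_summable(1)[OF f]]
  show "B_seq a b f \<in> ell1 w"
    using * B_seq_eq_kernel_op[OF f] by (simp add: ell1_def kernel_op_def)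
  show "nrm (B_seq a b f) \<le> nrm (\<lambda>n. a n * f n)"
    using * B_seq_eq_kernel_op[OF f] a_nonneg by (simp add: ell1_norm_def abs_mult mult.assoc)
qed

lemma AB_ell1: "f \<in> domA \<Longrightarrow> AB f \<in> ell1 w"
  using ell1_add[OF ell1_scale[of "\<lambda>n. a n * f n" "-1"] B_ell1[of f]]
  by (simp add: AB_def[abs_def] domA_def)

text \<open>By the relative bound the domain of A lies in that of B, so the sum has exactly the
  domain of A.\<close>

lemma op_sum_AB: "op_sum (A_op w a) (B_op w a b) = {(f, AB f) | f. f \<in> domA}"
proof -
  have "(f, B_seq a b f) \<in> B_op w a b" if "f \<in> domA" for f
    using that B_ell1 B_summable by (auto simp: B_op_def domA_def)
  then show ?thesis
    by (fastforce simp: op_sum_def A_op_def B_op_def domA_def AB_def[abs_def])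
qed

lemma domA_diff: "f \<in> domA \<Longrightarrow> g \<in> domA \<Longrightarrow> (\<lambda>n. f n - g n) \<in> domA"
  using ell1_diff[of "\<lambda>n. a n * f n" "\<lambda>n. a n * g n"] ell1_diff[of f g]
  by (simp add: domA_def algebra_simps)

lemma AB_diff: "f \<in> domA \<Longrightarrow> g \<in> domA \<Longrightarrow> AB (\<lambda>n. f n - g n) = (\<lambda>n. AB f n - AB g n)"
proof -
  assume f: "f \<in> domA" and g: "g \<in> domA"
  have "kernel_op bker (\<lambda>n. f n - g n) n = kernel_op bker f n - kernel_op bker g n" for n
    using suminf_diff[OF bker_summable(2)[OF f, of n] bker_summable(2)[OF g, of n]]
    by (cases "n = 0") (simp_all add: kernel_op_def right_diff_distrib)
  then show ?thesis
    using f g by (simp add: AB_def fun_eq_iff B_seq_eq_kernel_op domA_diff right_diff_distrib)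
qed

lemma AB_nrm: "f \<in> domA \<Longrightarrow> nrm (AB f) \<le> 2 * nrm (\<lambda>n. a n * f n)"
  using nrm_diff[OF B_ell1[of f], of "\<lambda>n. a n * f n"] B_nrm[of f]
  by (simp add: AB_def[abs_def] domA_def)

lemma fin_seq_domA: "fin_seq N f \<Longrightarrow> f \<in> domA"
  using fin_seq_ell1(1)[of N f] fin_seq_ell1(1)[of N "\<lambda>n. a n * f n"] by (simp add: domA_def fin_seq_def)

lemma AB_fin_seq:
  assumes f: "fin_seq N f"
  shows "1 \<le> n \<Longrightarrow> AB f n = (\<Sum>j=1..N. q n j * f j)" and "fin_seq N (AB f)"
proof -
  show *: "AB f n = (\<Sum>j=1..N. q n j * f j)" if n: "1 \<le> n" for n
  proof -
    have "q n j * f j = (if j = n then - a n * f n else 0) + bker n j * f j" if "j \<in> {1..N}" for j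
      using that n b_zero by (auto simp: q_def bker_def)
    then have "(\<Sum>j=1..N. q n j * f j) = (\<Sum>j=1..N. if j = n then - a n * f n else 0) + (\<Sum>j=1..N. bker n j * f j)"
      by (simp only: sum.distrib[symmetric] cong: sum.cong)
    then show ?thesis
      using f n by (auto simp: AB_def B_seq_eq_kernel_op[OF fin_seq_domA[OF f]] kernel_op_fin_seq[OF f n] fin_seq_def)
  qed
  have "q n j = 0" if "N < n" "j \<in> {1..N}" for n j using that by (auto intro: q_lower)
  then show "fin_seq N (AB f)"
    unfolding fin_seq_def using f * by (auto simp: AB_def B_seq_def fin_seq_def)
qed

section \<open>The generator of the kernel semigroup\<close>

lemma gen_fin_seq:
  assumes f: "fin_seq N f"
  shows "(f, AB f) \<in> kernel_flow.gen"
proof -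
  have "ell1_tendsto w (\<lambda>h n. (kernel_flow h f n - f n) / h) (AB f) (at_right 0)"
  proof (rule fin_seq_tendsto)
    fix n assume n: "1 \<le> n" "n \<le> N"
    have "((\<lambda>h. \<Sum>j=1..N. (kernel h n j - kernel 0 n j) / h * f j) \<longlongrightarrow> (\<Sum>j=1..N. q n j * f j)) (at_right 0)"
      using n by (intro tendsto_sum tendsto_mult kernel_quotient tendsto_const) auto
    moreover have "(\<Sum>j=1..N. (kernel h n j - kernel 0 n j) / h * f j) = (kernel_flow h f n - f n) / h" for h
    proof -
      have "f n = (\<Sum>j=1..N. kernel 0 n j * f j)"
        using kernel_flow_0[OF fin_seq_ell1(1)[OF f]] kernel_flow_fin_seq(1)[OF f n(1), of 0] by simp
      then show ?thesis
        by (simp add: kernel_flow_fin_seq(1)[OF f n(1)] sum_subtractf[symmetric] sum_divide_distrib left_diff_distrib)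
    qed
    ultimately show "((\<lambda>h. (kernel_flow h f n - f n) / h) \<longlongrightarrow> AB f n) (at_right 0)"
      using n by (simp add: AB_fin_seq(1)[OF f])
  next
    show "eventually (\<lambda>h. fin_seq N (\<lambda>n. (kernel_flow h f n - f n) / h)) (at_right 0)"
      using f kernel_flow_fin_seq(2)[OF f] by (simp add: fin_seq_def)
  qed (rule AB_fin_seq(2)[OF f])
  then show ?thesis
    using fin_seq_ell1(1)[OF f] fin_seq_ell1(1)[OF AB_fin_seq(2)[OF f]]
    by (simp add: semigroup_generator_def)
qed

text \<open>The generator is closed, so only the convergence of \<open>AB (trunc N f)\<close> is at
  stake. \<open>AB_nrm\<close> reduces it to the truncation error of \<open>a n * f n\<close>, as
  multiplication by \<open>a\<close> commutes with truncation.\<close>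

lemma gen_domA:
  assumes f: "f \<in> domA"
  shows "(f, AB f) \<in> kernel_flow.gen"
proof (rule kernel_flow.gen_closed)
  have fe: "f \<in> ell1 w" and af: "(\<lambda>n. a n * f n) \<in> ell1 w" using f by (auto simp: domA_def)
  have fN: "fin_seq N (trunc N f)" for N by (rule fin_seq_trunc[of f, OF ell1_0[OF fe]])
  show "(trunc N f, AB (trunc N f)) \<in> kernel_flow.gen" for N by (rule gen_fin_seq[OF fN])
  show "ell1_tendsto w (\<lambda>N. trunc N f) f sequentially" by (rule trunc_tendsto[OF fe])
  show "ell1_tendsto w (\<lambda>N. AB (trunc N f)) (AB f) sequentially"
  proof (rule ell1_tendstoI_le)
    have "(\<lambda>N. 2 * nrm (\<lambda>n. trunc N (\<lambda>n. a n * f n) n - a n * f n)) \<longlonglongrightarrow> 2 * 0"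
      using trunc_tendsto[OF af] unfolding ell1_tendsto_def by (intro tendsto_intros)
    then show "(\<lambda>N. 2 * nrm (\<lambda>n. trunc N (\<lambda>n. a n * f n) n - a n * f n)) \<longlonglongrightarrow> 0" by simp
    have "nrm (\<lambda>n. AB (trunc N f) n - AB f n) \<le> 2 * nrm (\<lambda>n. trunc N (\<lambda>n. a n * f n) n - a n * f n)" for N
    proof -
      note d = fin_seq_domA[OF fN[of N]]
      have *: "(\<lambda>n. a n * (trunc N f n - f n)) = (\<lambda>n. trunc N (\<lambda>n. a n * f n) n - a n * f n)"
        by (auto simp: trunc_def)
      show ?thesis using AB_nrm[OF domA_diff[OF d f]] unfolding AB_diff[OF d f] * .
    qed
    then show "eventually (\<lambda>N. nrm (\<lambda>n. AB (trunc N f) n - AB f n)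
        \<le> 2 * nrm (\<lambda>n. trunc N (\<lambda>n. a n * f n) n - a n * f n)) sequentially" by simp
    show "eventually (\<lambda>N. AB (trunc N f) \<in> ell1 w) sequentially"
      using AB_ell1[OF fin_seq_domA[OF fN]] by simp
  qed (rule AB_ell1[OF f])
  show "f \<in> ell1 w" by (rule fe)
  show "AB f \<in> ell1 w" by (rule AB_ell1[OF f])
qed

text \<open>Back substitution again: changing entry \<open>m\<close> leaves the later rows
  untouched, and row \<open>m\<close> has the diagonal coefficient
  \<open>1 + a m > 0\<close>.\<close>

lemma resolvent_fin_seq:
  assumes h: "fin_seq N h"
  shows "\<exists>f. fin_seq N f \<and> (\<lambda>n. f n - AB f n) = h"
proof -
  have "1 \<le> Suc N \<Longrightarrow> \<exists>f. fin_seq N f \<and> (\<forall>n\<in>{1..N}. f n - (\<Sum>j=1..N. q n j * f j) = h n)"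
  proof (rule inc_induct[where P = "\<lambda>m. \<exists>f. fin_seq N f \<and> (\<forall>n\<in>{m..N}. f n - (\<Sum>j=1..N. q n j * f j) = h n)"])
    show "\<exists>f. fin_seq N f \<and> (\<forall>n\<in>{Suc N..N}. f n - (\<Sum>j=1..N. q n j * f j) = h n)"
      by (intro exI[of _ "\<lambda>_. 0"]) (simp add: fin_seq_def)
    fix m assume m: "1 \<le> m" "m < Suc N"
      and "\<exists>f. fin_seq N f \<and> (\<forall>n\<in>{Suc m..N}. f n - (\<Sum>j=1..N. q n j * f j) = h n)"
    then obtain f where f: "fin_seq N f" "\<And>n. n \<in> {Suc m..N} \<Longrightarrow> f n - (\<Sum>j=1..N. q n j * f j) = h n"
      by blast
    define c where "c = (\<Sum>j\<in>{1..N} - {m}. q m j * f j)"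
    define g where "g = f(m := (h m + c) / (1 + a m))"
    have am: "1 + a m \<noteq> 0" using a_nonneg[OF m(1)] by linarith
    have "(\<Sum>j=1..N. q m j * g j) = q m m * g m + c"
      unfolding c_def using m by (subst sum.remove[of _ m]) (auto simp: g_def intro!: sum.cong)
    moreover have "(1 + a m) * g m = h m + c" using am by (simp add: g_def)
    ultimately have "g m - (\<Sum>j=1..N. q m j * g j) = h m" by (simp add: q_def algebra_simps)
    moreover have "g n - (\<Sum>j=1..N. q n j * g j) = h n" if "n \<in> {Suc m..N}" for n
    proof -
      have "(\<Sum>j=1..N. q n j * g j) = (\<Sum>j=1..N. q n j * f j)"
        using that m by (intro sum.cong) (auto simp: g_def q_lower)
      then show ?thesis using f(2)[OF that] that by (simp add: g_def)
    qed
    moreover have "fin_seq N g" using f(1) m by (auto simp: g_def fin_seq_def)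
    ultimately show "\<exists>f. fin_seq N f \<and> (\<forall>n\<in>{m..N}. f n - (\<Sum>j=1..N. q n j * f j) = h n)"
      by (intro exI[of _ g]) (auto simp: le_eq_less_or_eq[of m] Suc_le_eq)
  qed
  then obtain f where f: "fin_seq N f" "\<And>n. n \<in> {1..N} \<Longrightarrow> f n - (\<Sum>j=1..N. q n j * f j) = h n"
    by auto
  have "f n - AB f n = h n" for n
    using f(2)[of n] h f(1) AB_fin_seq[OF f(1)]
    by (cases "n \<in> {1..N}") (auto simp: fin_seq_def not_le)
  with f(1) show ?thesis by auto
qed

text \<open>In the core argument, dissipativity turns convergence of \<open>F N - AB (F N) = trunc N h\<close> into
  convergence of \<open>F N\<close> itself.\<close>

lemma gen_eq_G_op: "kernel_flow.gen = G_op w a b"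
proof (intro equalityI subrelI)
  fix f g assume "(f, g) \<in> G_op w a b"
  then obtain F G where e: "f \<in> ell1 w" "g \<in> ell1 w"
    and FG: "\<And>k. (F k, G k) \<in> op_sum (A_op w a) (B_op w a b)"
    and lim: "ell1_tendsto w F f sequentially" "ell1_tendsto w G g sequentially"
    by (auto simp: G_op_def op_closure_def)
  show "(f, g) \<in> kernel_flow.gen"
    by (rule kernel_flow.gen_closed[OF _ lim e]) (use FG gen_domA in \<open>auto simp: op_sum_AB\<close>)
next
  fix f g assume fg: "(f, g) \<in> kernel_flow.gen"
  note e = kernel_flow.gen_ell1[OF fg]
  define h where "h n = f n - g n" for n
  have h: "h \<in> ell1 w" unfolding h_def using e by (rule ell1_diff)
  have "\<exists>F. fin_seq N F \<and> (\<lambda>n. F n - AB F n) = trunc N h" for N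
    by (rule resolvent_fin_seq[OF fin_seq_trunc[of h, OF ell1_0[OF h]]])
  then obtain F where F: "\<And>N. fin_seq N (F N)" and FQ: "\<And>N. (\<lambda>n. F N n - AB (F N) n) = trunc N h"
    by metis
  note Fe = fin_seq_ell1(1)[OF F]
  have limh: "ell1_tendsto w (\<lambda>N. trunc N h) h sequentially" by (rule trunc_tendsto[OF h])
  have limF: "ell1_tendsto w F f sequentially"
  proof (rule ell1_tendstoI_le)
    show "(\<lambda>N. nrm (\<lambda>n. trunc N h n - h n)) \<longlonglongrightarrow> 0" using limh by (simp add: ell1_tendsto_def)
    have "nrm (\<lambda>n. F N n - f n) \<le> nrm (\<lambda>n. trunc N h n - h n)" for N
      using kernel_flow.gen_dissipative[OF kernel_flow.gen_diff[OF gen_fin_seq[OF F] fg], of 1 N]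
      unfolding FQ[symmetric] h_def by (simp add: algebra_simps)
    then show "eventually (\<lambda>N. nrm (\<lambda>n. F N n - f n) \<le> nrm (\<lambda>n. trunc N h n - h n)) sequentially"
      by simp
  qed (use Fe e in auto)
  have "ell1_tendsto w (\<lambda>N n. F N n - trunc N h n) (\<lambda>n. f n - h n) sequentially"
    using limF limh Fe e h fin_seq_ell1(1)[OF fin_seq_trunc[of h, OF ell1_0[OF h]]]
    by (intro ell1_tendsto_diff) auto
  then have "ell1_tendsto w (\<lambda>N. AB (F N)) g sequentially"
    unfolding FQ[symmetric] h_def by simp
  moreover have "(F N, AB (F N)) \<in> op_sum (A_op w a) (B_op w a b)" for N
    using fin_seq_domA[OF F] by (auto simp: op_sum_AB)
  ultimately have "\<exists>F G. (\<forall>k. (F k, G k) \<in> op_sum (A_op w a) (B_op w a b)) \<and>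
      ell1_tendsto w F f sequentially \<and> ell1_tendsto w G g sequentially"
    using limF by (intro exI[of _ F] exI[of _ "\<lambda>N. AB (F N)"]) simp
  with e show "(f, g) \<in> G_op w a b" by (simp add: G_op_def op_closure_def)
qed

end

section \<open>Classical solutions\<close>

lemma ell1_continuous_on_subset:
  "ell1_continuous_on w I u \<Longrightarrow> J \<subseteq> I \<Longrightarrow> ell1_continuous_on w J u"
  unfolding ell1_continuous_on_def ell1_tendsto_def by (blast intro: tendsto_within_subset)

context fragmentation begin

text \<open>The kernel semigroup witnesses that the choice defining \<open>frag_semigroup\<close>
  has something to choose from.\<close>

lemma frag_semigroup_substochastic: "substochastic_semigroup w (frag_semigroup w a b)"
  and frag_semigroup_generator: "semigroup_generator w (frag_semigroup w a b) = G_op w a b"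
proof -
  have "\<exists>S. substochastic_semigroup w S \<and> semigroup_generator w S = G_op w a b"
    using kernel_flow_substochastic gen_eq_G_op by blast
  from someI_ex[OF this]
  show "substochastic_semigroup w (frag_semigroup w a b)"
    and "semigroup_generator w (frag_semigroup w a b) = G_op w a b"
    unfolding frag_semigroup_def by auto
qed

sublocale frag: contraction_semigroup w "frag_semigroup w a b"
  by (rule substochastic_imp_contraction[OF frag_semigroup_substochastic])

lemma frag_gen_domA: "f \<in> domA \<Longrightarrow> (f, AB f) \<in> frag.gen"
  using gen_domA by (simp add: gen_eq_G_op frag_semigroup_generator)

text \<open>The generators coincide, so a kernel orbit is a solution for the chosen semigroup and
  \<open>gen_solution_unique\<close> identifies the two; that lemma asks the orbit to start in the
  domain of the generator.\<close>

lemma frag_semigroup_eq_kernel_flow: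
  assumes f: "f \<in> domA" and t: "0 \<le> t"
  shows "frag_semigroup w a b t f = kernel_flow t f"
proof -
  have fe: "f \<in> ell1 w" using f by (simp add: domA_def)
  have "kernel_flow t f = frag_semigroup w a b t (kernel_flow 0 f)"
  proof (rule frag.gen_solution_unique[OF _ _ _ _ t])
    show "ell1_has_derivative_at w (\<lambda>t. kernel_flow t f) (kernel_flow t (AB f)) t" if "0 < t" for t
      by (rule kernel_flow.S_has_derivative[OF gen_domA[OF f] that])
    show "(kernel_flow t f, kernel_flow t (AB f)) \<in> frag.gen" if "0 < t" for t
      using kernel_flow.gen_invariant[OF gen_domA[OF f], of t] that
      by (simp add: gen_eq_G_op frag_semigroup_generator)
    show "(kernel_flow 0 f, AB f) \<in> frag.gen" using frag_gen_domA[OF f] kernel_flow_0[OF fe] by simp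
  qed (rule kernel_flow.S_continuous[OF fe])
  then show ?thesis using kernel_flow_0[OF fe] by simp
qed

lemma classical_solution_imp_eq_frag_semigroup:
  assumes v: "classical_solution w a b f v" and f: "f \<in> domA" and t: "0 \<le> t"
  shows "v t = frag_semigroup w a b t f"
proof -
  from v obtain v' where cont: "ell1_continuous_on w {0..} v" and init: "v 0 = f"
    and der: "\<And>t. 0 < t \<Longrightarrow> ell1_has_derivative_at w v (v' t) t"
    and eq: "\<And>t. 0 < t \<Longrightarrow> (v t, v' t) \<in> op_sum (A_op w a) (B_op w a b)"
    unfolding classical_solution_def by blast
  have "(v t, v' t) \<in> frag.gen" if "0 < t" for t
    using eq[OF that] frag_gen_domA by (auto simp: op_sum_AB)
  from frag.gen_solution_unique[OF cont der this _ t, of "AB f"] frag_gen_domA[OF f] init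
  show ?thesis by simp
qed

text \<open>The derivative is the orbit of \<open>AB f\<close>, hence continuous. At time
  \<open>t\<close> this orbit and \<open>AB (u t)\<close> are both generator values at
  \<open>u t\<close>, the latter by invariance of \<open>domA\<close>, and the generator is
  single-valued.\<close>

lemma frag_semigroup_classical_solution:
  assumes f: "f \<in> domA" and inv: "\<And>t. 0 \<le> t \<Longrightarrow> frag_semigroup w a b t f \<in> domA"
  shows "classical_solution w a b f (\<lambda>t. frag_semigroup w a b t f)"
proof -
  let ?u = "\<lambda>t. frag_semigroup w a b t f" and ?u' = "\<lambda>t. frag_semigroup w a b t (AB f)"
  have fe: "f \<in> ell1 w" using f by (simp add: domA_def)
  have eq: "(?u t, ?u' t) \<in> op_sum (A_op w a) (B_op w a b)" if "0 < t" for t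
    using frag.gen_functional[OF frag.gen_invariant[OF frag_gen_domA[OF f], of t] frag_gen_domA[OF inv, of t]]
      inv[of t] that by (auto simp: op_sum_AB)
  have dom: "?u t \<in> Domain (A_op w a) \<inter> Domain (B_op w a b)" if "0 < t" for t
    using eq[OF that] by (auto simp: op_sum_def)
  have "ell1_continuous_on w {0<..} ?u'"
    by (rule ell1_continuous_on_subset[OF frag.S_continuous[OF AB_ell1[OF f]]]) auto
  with eq dom show ?thesis
    unfolding classical_solution_def
    using frag.S_continuous[OF fe] frag.S_0[OF fe] frag.S_has_derivative[OF frag_gen_domA[OF f]]
    by blast
qed

section \<open>Mass conservation\<close>

lemma kernel_mass:
  assumes a1: "a 1 = 0" and mass: "\<And>j. 2 \<le> j \<Longrightarrow> (\<Sum>n=1..j-1. real n * b n j) = real j"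
    and j: "1 \<le> j" "j \<le> N" and t: "0 \<le> t"
  shows "(\<Sum>n=1..N. real n * kernel t n j) = real j"
proof -
  \<comment> \<open>For \<open>i = 1\<close> the fragment sum is empty and the column vanishes by
    \<open>a 1 = 0\<close>; for larger \<open>i\<close> gain and loss both equal
    \<open>a i * real i\<close>.\<close>
  have 0: "(\<Sum>n=1..j. real n * q n i) = 0" if "1 \<le> i" "i \<le> j" for i
    using q_column_sum[OF that, of real] a1 mass[of i] that by (cases "i = 1") auto
  have "(\<Sum>n=1..j. real n * kernel t n j) \<le> real j"
    using 0 by (intro kernel_column_sum_le j t) simp
  \<comment> \<open>The weight \<open>- n\<close> gives the reverse inequality.\<close>
  moreover have "(\<Sum>n=1..j. - real n * kernel t n j) \<le> - real j"
    using 0 by (intro kernel_column_sum_le j t) (simp add: sum_negf)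
  moreover have "(\<Sum>n=1..N. real n * kernel t n j) = (\<Sum>n=1..j. real n * kernel t n j)"
    using j by (intro sum.mono_neutral_right) (auto simp: kernel_outside)
  ultimately show ?thesis by (simp add: sum_negf)
qed

text \<open>The bound \<open>n <= w n\<close> makes \<open>M1\<close> continuous on
  \<open>ell1 w\<close>, so conservation passes from truncations to \<open>f\<close>; the factor 2
  counts the truncation errors before and after the flow.\<close>

lemma kernel_flow_mass:
  assumes w_ge: "\<And>n. 1 \<le> n \<Longrightarrow> real n \<le> w n"
    and a1: "a 1 = 0" and mass: "\<And>j. 2 \<le> j \<Longrightarrow> (\<Sum>n=1..j-1. real n * b n j) = real j"
    and f: "f \<in> ell1 w" and t: "0 \<le> t"
  shows "M1 (kernel_flow t f) = M1 f"
proof -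
  have s: "summable (\<lambda>n. real (Suc n) * g (Suc n))" and le: "\<bar>M1 g\<bar> \<le> nrm g"
    if g: "g \<in> ell1 w" for g
  proof -
    have *: "norm (real (Suc n) * g (Suc n)) \<le> w (Suc n) * \<bar>g (Suc n)\<bar>" for n
      using w_ge[of "Suc n"] by (simp add: abs_mult mult_right_mono)
    show "summable (\<lambda>n. real (Suc n) * g (Suc n))"
      by (rule summable_comparison_test'[OF ell1_summable[OF g], of 0]) (rule *)
    show "\<bar>M1 g\<bar> \<le> nrm g"
      using norm_suminf_le[OF * ell1_summable[OF g]] by (simp add: M1_def ell1_norm_def)
  qed
  have diff: "\<bar>M1 g - M1 h\<bar> \<le> nrm (\<lambda>n. g n - h n)" if "g \<in> ell1 w" "h \<in> ell1 w" for g h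
    using le[OF ell1_diff[OF that]] suminf_diff[OF s[OF that(1)] s[OF that(2)]]
    by (simp add: M1_def right_diff_distrib)
  have fin: "M1 g = (\<Sum>n=1..N. real n * g n)" if "fin_seq N g" for g N
    using suminf_fin_seq(1)[of N "\<lambda>n. real n * g n"] that by (simp add: M1_def fin_seq_def)
  have kernel_flow_fin: "M1 (kernel_flow t g) = M1 g" if g: "fin_seq N g" for g N
  proof -
    have "M1 (kernel_flow t g) = (\<Sum>n=1..N. real n * (\<Sum>j=1..N. kernel t n j * g j))"
      unfolding fin[OF kernel_flow_fin_seq(2)[OF g]] using kernel_flow_fin_seq(1)[OF g] by simp
    also have "\<dots> = (\<Sum>j=1..N. (\<Sum>n=1..N. real n * kernel t n j) * g j)"
      unfolding sum_distrib_left sum_distrib_right by (subst sum.swap) (simp add: mult.assoc)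
    also have "\<dots> = (\<Sum>j=1..N. real j * g j)"
      by (rule sum.cong) (use kernel_mass[OF a1 mass _ _ t] in auto)
    finally show ?thesis by (simp add: fin[OF g])
  qed
  have "\<bar>M1 (kernel_flow t f) - M1 f\<bar> \<le> 2 * nrm (\<lambda>n. trunc N f n - f n)" for N
  proof -
    have fN: "fin_seq N (trunc N f)" by (rule fin_seq_trunc[of f, OF ell1_0[OF f]])
    note e = fin_seq_ell1(1)[OF fN]
    show ?thesis
      using diff[OF kernel_flow_ell1[OF e t] kernel_flow_ell1[OF f t]] diff[OF e f] kernel_flow_diff_contr[OF e f t] kernel_flow_fin[OF fN]
      by linarith
  qed
  moreover have "(\<lambda>N. 2 * nrm (\<lambda>n. trunc N f n - f n)) \<longlonglongrightarrow> 2 * 0"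
    using trunc_tendsto[OF f] unfolding ell1_tendsto_def by (intro tendsto_intros)
  ultimately have "\<bar>M1 (kernel_flow t f) - M1 f\<bar> \<le> 2 * 0"
    using LIMSEQ_le_const by blast
  then show ?thesis by simp
qed

end

theorem theorem3p7:
  fixes a c w :: "nat \<Rightarrow> real" and b :: "nat \<Rightarrow> nat \<Rightarrow> real" and u0 :: "nat \<Rightarrow> real"
  assumes a_nonneg: "\<forall>n\<ge>1. 0 \<le> a n"
    and b_nonneg: "\<forall>n\<ge>1. \<forall>j\<ge>1. 0 \<le> b n j"
    and b_zero: "\<forall>n\<ge>1. \<forall>j\<ge>1. n \<ge> j \<longrightarrow> b n j = 0"
    and weight: "\<forall>n\<ge>1. 0 < w n"
    and w_ge: "\<forall>n\<ge>1. real n \<le> w n"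
    and kappa: "\<exists>\<kappa>::real. 0 < \<kappa> \<and> \<kappa> \<le> 1 \<and> (\<forall>j\<ge>2. (\<Sum>n=1..j-1. w n * b n j) \<le> \<kappa> * w j)"
    and c_mono: "\<forall>n\<ge>1. c n \<le> c (n + 1)"
    and a_le_c: "\<forall>n\<ge>1. a n \<le> c n"
    and u0: "u0 \<in> Domain (C_op w c)"
  shows "classical_solution w a b u0 (\<lambda>t. frag_semigroup w a b t u0) \<and>
    (\<forall>v. classical_solution w a b u0 v \<longrightarrow> (\<forall>t\<ge>0. v t = frag_semigroup w a b t u0)) \<and>
    (nonneg_seq u0 \<longrightarrow> nonneg_solution (\<lambda>t. frag_semigroup w a b t u0)) \<and>
    (a 1 = 0 \<and> (\<forall>j\<ge>2. (\<Sum>n=1..j-1. real n * b n j) = real j) \<and> nonneg_seq u0 \<longrightarrow>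
       mass_conserving u0 (\<lambda>t. frag_semigroup w a b t u0))"
proof -
  have w_b: "(\<Sum>n=1..j-1. w n * b n j) \<le> w j" if j: "2 \<le> j" for j
  proof -
    from kappa obtain \<kappa> where "\<kappa> \<le> 1" "(\<Sum>n=1..j-1. w n * b n j) \<le> \<kappa> * w j" using j by blast
    moreover have "\<kappa> * w j \<le> w j" using \<open>\<kappa> \<le> 1\<close> weight j by simp
    ultimately show ?thesis by linarith
  qed
  interpret fragmentation w a b
    by unfold_locales (use assms w_b in auto)
  have c_nonneg: "0 \<le> c n" if "1 \<le> n" for n using a_nonneg a_le_c that by (meson order_trans)
  have c_le: "c n \<le> c j" if "1 \<le> n" "n \<le> j" for n j
    using that(2)
  proof (induction rule: dec_induct)
    case (step m)
    then show ?case using c_mono that(1) by (auto intro: order_trans)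
  qed simp
  have adm: "admissible (\<lambda>n. w n * c n)"
    unfolding admissible_def
  proof (intro conjI allI impI)
    fix j :: nat assume j: "2 \<le> j"
    \<comment> \<open>Only sizes \<open>n < j\<close> contribute, so every \<open>c n\<close> may be
      replaced by \<open>c j\<close> and pulled out.\<close>
    have "(\<Sum>n=1..j-1. w n * c n * b n j) \<le> (\<Sum>n=1..j-1. c j * (w n * b n j))"
    proof (rule sum_mono)
      fix n assume "n \<in> {1..j-1}"
      then have "1 \<le> n" "n \<le> j" by auto
      then show "w n * c n * b n j \<le> c j * (w n * b n j)"
        using mult_right_mono[OF c_le[of n j], of "w n * b n j"] w_nonneg[of n] b_nonneg j
        by (simp add: mult.commute mult.left_commute)
    qed
    also have "\<dots> \<le> c j * w j"
      unfolding sum_distrib_left[symmetric] using w_b[OF j] c_nonneg[of j] j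
      by (intro mult_left_mono) auto
    finally show "(\<Sum>n=1..j-1. w n * c n * b n j) \<le> w j * c j" by (simp add: mult.commute)
  qed (simp add: w_nonneg c_nonneg)
  have domC_domA: "f \<in> domA"
    if f: "f \<in> ell1 w" and s: "summable (\<lambda>n. w (Suc n) * c (Suc n) * \<bar>f (Suc n)\<bar>)" for f
  proof -
    have "norm (w (Suc n) * \<bar>a (Suc n) * f (Suc n)\<bar>) \<le> w (Suc n) * c (Suc n) * \<bar>f (Suc n)\<bar>" for n
      using a_nonneg a_le_c w_nonneg[of "Suc n"]
      by (simp add: abs_mult mult.assoc mult_left_mono mult_right_mono)
    then have "summable (\<lambda>n. w (Suc n) * \<bar>a (Suc n) * f (Suc n)\<bar>)"
      by (intro summable_comparison_test'[OF s, of 0])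
    with f show ?thesis by (simp add: domA_def ell1_def)
  qed
  from u0 have u0_ell1: "u0 \<in> ell1 w"
    and u0_C: "summable (\<lambda>n. w (Suc n) * c (Suc n) * \<bar>u0 (Suc n)\<bar>)"
    by (auto simp: C_op_def)
  have u0_A: "u0 \<in> domA" by (rule domC_domA[OF u0_ell1 u0_C])
  \<comment> \<open>Substochasticity refers to the weight \<open>w\<close> alone; passing to the
    kernel flow makes the column estimate for \<open>w * c\<close> available.\<close>
  have inv: "frag_semigroup w a b t u0 \<in> domA" if "0 \<le> t" for t
    unfolding frag_semigroup_eq_kernel_flow[OF u0_A that]
    by (rule domC_domA[OF kernel_flow_ell1[OF u0_ell1 that] kernel_flow_admissible(1)[OF u0_ell1 that adm u0_C]])
  have "nonneg_solution (\<lambda>t. frag_semigroup w a b t u0)" if "nonneg_seq u0"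
    using frag_semigroup_substochastic that u0_ell1
    by (auto simp: substochastic_semigroup_def nonneg_solution_def)
  moreover have "mass_conserving u0 (\<lambda>t. frag_semigroup w a b t u0)"
    if "a 1 = 0" "\<forall>j\<ge>2. (\<Sum>n=1..j-1. real n * b n j) = real j"
    unfolding mass_conserving_def
    using frag_semigroup_eq_kernel_flow[OF u0_A] kernel_flow_mass[OF _ that(1) _ u0_ell1] w_ge that(2) by simp
  ultimately show ?thesis
    using frag_semigroup_classical_solution[OF u0_A inv]
      classical_solution_imp_eq_frag_semigroup[OF _ u0_A] by blast
qed

end
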